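(* Let $I$ be an open interval of $\mathbb R$ and $\gamma,\alpha:I\to\mathbb R$ be locally bounded functions with $\alpha\ge0$. Let $\sigma,\tau\in\mathbb C$ and $\tilde f\in\tilde{\mathscr G}_\sigma(I,\gamma,\alpha)$, $\tilde g\in\tilde{\mathscr G}_\tau(I,\gamma)$. Then $\tilde g\circ\tilde f\in\tilde{\mathscr G}_{\sigma+\tau}(I,\gamma_1)$ with $\gamma_1=\gamma+|\sigma|+\sqrt\alpha$, the function $\mathcal S^I\tilde f$ maps $\mathcal D(I,\gamma_1)$ in $\mathcal D(I,\gamma)$, and $$\mathcal S^I(\tilde g\circ\tilde f)=(\mathcal S^I\tilde g)\circ(\mathcal S^I\tilde f)\quad\text{on }\mathcal D(I,\gamma_1).$$
   Context: $\tilde{\mathscr G}=\mathrm{id}+\mathbb C[[z^{-1}]]$ with composition $(\mathrm{id}+\tilde\varphi)\circ(\mathrm{id}+\tilde\chi)=\mathrm{id}+\tilde\chi+\sum_{p\ge0}\frac1{p!}\tilde\chi^p\partial^p\tilde\varphi$, $\partial=d/dz$; $\tilde{\mathscr G}_\sigma=\mathrm{id}+\sigma+z^{-1}\mathbb C[[z^{-1}]]$. The formal Borel transform is $\mathcal B(a+\sum_{n\ge0}a_nz^{-n-1})=a\delta+\sum a_n\frac{\zeta^n}{n!}$, $\delta$ a symbol. A function on $I$ is locally bounded if bounded on compact subintervals. $\mathcal N(I,\gamma,\alpha)$ is the set of $\hat\varphi\in\mathbb C\{\zeta\}$ extending analytically to $\{\xi e^{\mathrm i\theta}\mid\xi>0,\theta\in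 I\}$ with $|\hat\varphi(\xi e^{\mathrm i\theta})|\le\alpha(\theta)e^{\gamma(\theta)\xi}$; $\mathcal N(I,\gamma)=\bigcup_\alpha\mathcal N(I,\gamma,\alpha)$. $\tilde{\mathscr G}_\sigma(I,\gamma,\alpha)$ (resp. $\tilde{\mathscr G}_\sigma(I,\gamma)$) is the set of $\tilde f=\mathrm{id}+\sigma+\tilde\varphi$ with $\tilde\varphi\in z^{-1}\mathbb C[[z^{-1}]]$ and $\mathcal B\tilde\varphi\in\mathcal N(I,\gamma,\alpha)$ (resp. $\mathcal N(I,\gamma)$). Let $\Pi^\theta_c=\{\mathrm{Re}(ze^{\mathrm i\theta})>c\}$, $\mathcal D(I,\gamma)=\bigcup_{\theta\in I}\Pi^\theta_{\gamma(\theta)}$. For such $\tilde f$, with $\hat\varphi=\mathcal B\tilde\varphi$, $\mathcal S^I\tilde f(z)=z+\sigma+\int_0^{+\infty}e^{-z\xi e^{\mathrm i\theta}}\hat\varphi(\xi e^{\mathrm i\theta})e^{\mathrm i\theta}d\xi$ for any $\theta\in I$ with $z\in\Pi^\theta_{\gamma(\theta)}$, a well-defined holomorphic function on $\mathcal D(I,\gamma)$. When $|I|>\pi$ one takes $\gamma>0$ and the half-planes are regarded as subsets of the Riemann surface of the logarithm, $\Pi^\theta_{\gamma(\theta)}$ being replaced by its lift $\{z=re^{\mathrm i t}\mid r>\gamma(\theta),\ |t+\theta|<\arccos(\gamma(\theta)/r)\}$ ($t=\arg z$ not modulo $2\pi$), and additions $z+\cdots$ are performed inside the lifted half-plane of the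 same direction $\theta$. *)

theory Defs
  imports "HOL-Complex_Analysis.Complex_Analysis"
begin

section \<open>Formal series tangent to the identity\<close>

text \<open>
  A power series in \<open>z\<inverse>\<close> is encoded as a \<open>complex fps\<close> in the variable \<open>fps_X = z\<inverse>\<close>, and the
  series \<open>id + \<psi>\<close> is encoded by its second part \<open>\<psi>\<close>.
\<close>

text \<open>As \<open>d/dz = - w\<^sup>2 d/dw\<close> for \<open>w = z\<inverse>\<close>:\<close>
definition dz :: "complex fps \<Rightarrow> complex fps" where
  "dz \<phi> = - (fps_X ^ 2 * fps_deriv \<phi>)"

text \<open>
  \<open>(id + \<phi>) \<circ> (id + \<psi>) = id + tang_comp \<phi> \<psi>\<close>. The sum is taken in the formal (\<open>fps_X\<close>-adic)
  topology of \<open>complex fps\<close>; it converges by \<open>tang_comp_sums\<close> below.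
\<close>
definition tang_comp :: "complex fps \<Rightarrow> complex fps \<Rightarrow> complex fps" where
  "tang_comp \<phi> \<psi> = \<psi> + (\<Sum>p. fps_const (1 / fact p) * \<psi> ^ p * (dz ^^ p) \<phi>)"

lemma dz_funpow_nth_eq_0: "n < p \<Longrightarrow> fps_nth ((dz ^^ p) \<phi>) n = 0"
proof (induction p arbitrary: n)
  case (Suc p)
  show ?case
  proof (cases "n < 2")
    case True
    then show ?thesis by (simp add: dz_def fps_X_power_mult_nth)
  next
    case False
    then have "fps_nth ((dz ^^ p) \<phi>) (n - 1) = 0"
      using Suc by (intro Suc.IH) auto
    moreover have "n - 2 + 1 = n - 1"
      using False by simp
    ultimately show ?thesis
      by (simp add: dz_def[of "(dz ^^ p) \<phi>"] fps_X_power_mult_nth del: One_nat_def)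
  qed
qed simp

lemma tang_comp_sums:
  "(\<lambda>p. fps_const (1 / fact p) * \<psi> ^ p * (dz ^^ p) \<phi>) sums
     Abs_fps (\<lambda>n. \<Sum>p\<le>n. fps_nth (fps_const (1 / fact p) * \<psi> ^ p * (dz ^^ p) \<phi>) n)"
proof -
  let ?t = "\<lambda>p. fps_const (1 / fact p) * \<psi> ^ p * (dz ^^ p) \<phi>"
  have zero: "fps_nth (?t p) n = 0" if "n < p" for p n
    unfolding fps_mult_nth[of "fps_const (1 / fact p) * \<psi> ^ p"]
    by (intro sum.neutral) (use that dz_funpow_nth_eq_0 in auto)
  show ?thesis
    unfolding sums_def
  proof (rule tendsto_fpsI)
    fix n
    have "fps_nth (\<Sum>p<m. ?t p) n = (\<Sum>p\<le>n. fps_nth (?t p) n)" if "n < m" for m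
      unfolding fps_sum_nth by (rule sum.mono_neutral_right) (use that zero in auto)
    then show "\<forall>\<^sub>F m in sequentially. fps_nth (\<Sum>p<m. ?t p) n =
        fps_nth (Abs_fps (\<lambda>n. \<Sum>p\<le>n. fps_nth (?t p) n)) n"
      by (auto intro: eventually_sequentiallyI[of "Suc n"])
  qed
qed

section \<open>Borel transform and the spaces of series\<close>

text \<open>
  The formal Borel transform of \<open>\<psi>\<close> is \<open>fps_nth \<psi> 0 \<cdot> \<delta> + borel_minor \<psi>\<close>; on series without
  constant term it is \<open>borel_minor\<close>.
\<close>
definition borel_minor :: "complex fps \<Rightarrow> complex fps" where
  "borel_minor \<psi> = Abs_fps (\<lambda>n. fps_nth \<psi> (Suc n) / fact n)"

definition locally_bounded_on :: "real set \<Rightarrow> (real \<Rightarrow> real) \<Rightarrow> bool" where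
  "locally_bounded_on I h \<longleftrightarrow> (\<forall>a b. {a..b} \<subseteq> I \<longrightarrow> bounded (h ` {a..b}))"

definition sector :: "real set \<Rightarrow> complex set" where
  "sector I = {of_real \<xi> * cis \<theta> | \<xi> \<theta>. 0 < \<xi> \<and> \<theta> \<in> I}"

text \<open>
  \<open>F\<close> is the analytic continuation to \<open>sector I\<close> of the convergent series \<open>\<phi>h\<close>. Positivity of the
  radius of convergence is part of \<open>has_fps_expansion\<close>. The continuation takes place along rays
  issuing from the origin, so it is single-valued however long \<open>I\<close> is.
\<close>
definition continues_to :: "real set \<Rightarrow> complex fps \<Rightarrow> (complex \<Rightarrow> complex) \<Rightarrow> bool" where
  "continues_to I \<phi>h F \<longleftrightarrow> F has_fps_expansion \<phi>h \<and> F holomorphic_on sector I"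

text \<open>Determined on \<open>sector I\<close> by the identity theorem, for \<open>I\<close> open and \<open>\<phi>h\<close> continuable.\<close>
definition continuation :: "real set \<Rightarrow> complex fps \<Rightarrow> complex \<Rightarrow> complex" where
  "continuation I \<phi>h = (SOME F. continues_to I \<phi>h F)"

definition N_bd :: "real set \<Rightarrow> (real \<Rightarrow> real) \<Rightarrow> (real \<Rightarrow> real) \<Rightarrow> complex fps set" where
  "N_bd I \<gamma> \<alpha> = {\<phi>h. \<exists>F. continues_to I \<phi>h F \<and>
     (\<forall>\<theta>\<in>I. \<forall>\<xi>>0. norm (F (of_real \<xi> * cis \<theta>)) \<le> \<alpha> \<theta> * exp (\<gamma> \<theta> * \<xi>))}"

definition N_sp :: "real set \<Rightarrow> (real \<Rightarrow> real) \<Rightarrow> complex fps set" where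
  "N_sp I \<gamma> = (\<Union>\<alpha>\<in>{\<alpha>. locally_bounded_on I \<alpha> \<and> (\<forall>\<theta>\<in>I. 0 \<le> \<alpha> \<theta>)}. N_bd I \<gamma> \<alpha>)"

definition G_bd :: "complex \<Rightarrow> real set \<Rightarrow> (real \<Rightarrow> real) \<Rightarrow> (real \<Rightarrow> real) \<Rightarrow> complex fps set" where
  "G_bd \<sigma> I \<gamma> \<alpha> = {fps_const \<sigma> + \<phi> | \<phi>. fps_nth \<phi> 0 = 0 \<and> borel_minor \<phi> \<in> N_bd I \<gamma> \<alpha>}"

definition G_sp :: "complex \<Rightarrow> real set \<Rightarrow> (real \<Rightarrow> real) \<Rightarrow> complex fps set" where
  "G_sp \<sigma> I \<gamma> = {fps_const \<sigma> + \<phi> | \<phi>. fps_nth \<phi> 0 = 0 \<and> borel_minor \<phi> \<in> N_sp I \<gamma>}"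

section \<open>Borel-Laplace summation in the plane\<close>

definition half_plane :: "real \<Rightarrow> real \<Rightarrow> complex set" where
  "half_plane \<theta> c = {z. Re (z * cis \<theta>) > c}"

definition D_dom :: "real set \<Rightarrow> (real \<Rightarrow> real) \<Rightarrow> complex set" where
  "D_dom I \<gamma> = (\<Union>\<theta>\<in>I. half_plane \<theta> (\<gamma> \<theta>))"

text \<open>
  Sum of \<open>id + \<psi>\<close> computed in the direction \<open>\<theta>\<close>. For \<open>\<psi> = \<sigma> + \<phi>\<close> with \<open>\<phi>\<close> without constant
  term, \<open>fps_nth \<psi> 0 = \<sigma>\<close> and \<open>borel_minor \<psi> = borel_minor \<phi>\<close>.
\<close>
definition dir_sum :: "real set \<Rightarrow> complex fps \<Rightarrow> real \<Rightarrow> complex \<Rightarrow> complex" where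
  "dir_sum I \<psi> \<theta> z = z + fps_nth \<psi> 0 +
     (LINT \<xi>:{0<..}|lborel. exp (- (z * of_real \<xi> * cis \<theta>)) *
        continuation I (borel_minor \<psi>) (of_real \<xi> * cis \<theta>) * cis \<theta>)"

text \<open>The common value of the sums in all admissible directions.\<close>
definition borel_sum :: "real set \<Rightarrow> (real \<Rightarrow> real) \<Rightarrow> complex fps \<Rightarrow> complex \<Rightarrow> complex" where
  "borel_sum I \<gamma> \<psi> z =
     (THE v. \<forall>\<theta>\<in>I. z \<in> half_plane \<theta> (\<gamma> \<theta>) \<longrightarrow> v = dir_sum I \<psi> \<theta> z)"

section \<open>Borel-Laplace summation on the Riemann surface of the logarithm\<close>

text \<open>The point \<open>r e\<^sup>i\<^sup>t\<close> of the surface is the pair \<open>(r, t)\<close> with \<open>r > 0\<close>, \<open>t\<close> not taken modulo \<open>2\<pi>\<close>.\<close>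
type_synonym log_point = "real \<times> real"

definition proj :: "log_point \<Rightarrow> complex" where
  "proj p = rcis (fst p) (snd p)"

text \<open>Used for \<open>c \<ge> 0\<close> only.\<close>
definition log_half_plane :: "real \<Rightarrow> real \<Rightarrow> log_point set" where
  "log_half_plane \<theta> c = {(r, t). r > c \<and> \<bar>t + \<theta>\<bar> < arccos (c / r)}"

definition log_D_dom :: "real set \<Rightarrow> (real \<Rightarrow> real) \<Rightarrow> log_point set" where
  "log_D_dom I \<gamma> = (\<Union>\<theta>\<in>I. log_half_plane \<theta> (\<gamma> \<theta>))"

text \<open>The sum as a complex-valued function on the lifted domain.\<close>
definition log_borel_sum :: "real set \<Rightarrow> (real \<Rightarrow> real) \<Rightarrow> complex fps \<Rightarrow> log_point \<Rightarrow> complex" where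
  "log_borel_sum I \<gamma> \<psi> p =
     (THE v. \<forall>\<theta>\<in>I. p \<in> log_half_plane \<theta> (\<gamma> \<theta>) \<longrightarrow> v = dir_sum I \<psi> \<theta> (proj p))"

text \<open>
  The sum as a point of the surface: the lift of its complex value to a half-plane
  \<open>log_half_plane \<theta> 0\<close> having the same direction as one in which the sum is computed. There may be
  none, as the complex value may vanish, for instance. Otherwise it is unique: two admissible
  directions at \<open>p\<close> differ by less than \<open>\<pi>\<close>, so the lifts differ in argument by less than \<open>2\<pi>\<close>.
\<close>
definition log_lift :: "real set \<Rightarrow> (real \<Rightarrow> real) \<Rightarrow> complex fps \<Rightarrow> log_point \<Rightarrow> log_point" where
  "log_lift I \<gamma> \<psi> p =
     (THE q. \<exists>\<theta>\<in>I. p \<in> log_half_plane \<theta> (\<gamma> \<theta>) \<and> q \<in> log_half_plane \<theta> 0 \<and>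
        proj q = dir_sum I \<psi> \<theta> (proj p))"

end

theory Submission
  imports Defs "HOL-Real_Asymp.Real_Asymp"
begin

text \<open>
  Write \<open>f = id + \<sigma> + \<phi>\<close> and \<open>g = id + \<tau> + \<eta>\<close>, with Borel transforms \<open>F\<close>, \<open>G\<close> of \<open>\<phi>\<close>, \<open>\<eta>\<close>.
  By Taylor's formula \<open>g \<circ> f = id + \<sigma> + \<tau> + \<phi> + \<Sum>p. \<phi>\<^sup>p/p! \<cdot> (d/dz)\<^sup>p \<eta>(z + \<sigma>)\<close>, whose Borel transform is
  \<open>F + \<Sum>p. F \<^bold>* \<dots> \<^bold>* F \<^bold>* ((- \<zeta>)\<^sup>p/p! \<cdot> e\<^bsup>-\<sigma>\<zeta>\<^esup> G)\<close> (\<open>p\<close> convolution factors \<open>F\<close>). If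
  \<open>\<bar>F\<bar> \<le> \<alpha> e\<^bsup>c\<xi>\<^esup>\<close> and \<open>\<bar>e\<^bsup>-\<sigma>\<zeta>\<^esup> G\<bar> \<le> \<beta> e\<^bsup>c\<xi>\<^esup>\<close> with \<open>c = \<gamma> + \<bar>\<sigma>\<bar>\<close>, the \<open>p\<close>-th term is at most
  \<open>\<beta> \<alpha>\<^sup>p \<xi>\<^bsup>2p\<^esup>/(2p)! \<cdot> e\<^bsup>c\<xi>\<^esup>\<close>, and summation over \<open>p\<close> costs the factor \<open>cosh (\<surd>\<alpha> \<xi>) \<le> e\<^bsup>\<surd>\<alpha> \<xi>\<^esup>\<close>.
  The Laplace transform turns convolution powers into powers of \<open>\<Phi> = \<L> F\<close>, so the series becomes
  \<open>\<Sum>p. \<Phi>\<^sup>p \<L> ((- \<zeta>)\<^sup>p/p! \<cdot> e\<^bsup>-\<sigma>\<zeta>\<^esup> G) = \<L> G (z + \<sigma> + \<Phi>)\<close>. Here \<open>\<bar>\<Phi>\<bar> \<le> \<surd>\<alpha>\<close>, which also gives the mapping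
  property of \<open>f\<close>.
\<close>

section \<open>Sectors and continuation\<close>

text \<open>The factorial (2p)! has two sources. The weight (-\<zeta>)^p/p! from Taylor's formula
  already has size \<xi>^p/p!, and each of the p convolutions with F integrates \<xi>^n/n! to
  \<xi>^(n+1)/(n+1)!. This doubled order of vanishing at 0 is why \<alpha> enters the exponent only
  through its square root. In the z-plane the same root appears as the margin at which
  \<alpha>/(Re(z e^(i \<theta>)) - c) drops to sqrt \<alpha>, so one margin serves both planes. The
  constant \<sigma> must be split off before convolution powers are formed, because its Borel
  transform is a multiple of \<delta> and not a function; it survives as a translation. All
  estimates and the composition identity hold in one fixed direction, since \<open>f\<close> maps a
  half-plane into one of the same direction. The sums, however, are defined as the common value over
  all admissible directions. Their agreement is a separate matter, made delicate by bounds that are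
  only locally uniform in \<theta>.\<close>

lemma sector_eq_exp: "sector I = exp ` {w. Im w \<in> I}"
proof (intro equalityI subsetI)
  fix x assume "x \<in> sector I"
  then obtain \<xi> \<theta> where *: "x = of_real \<xi> * cis \<theta>" "\<xi> > 0" "\<theta> \<in> I"
    by (auto simp: sector_def)
  then have "x = exp (Complex (ln \<xi>) \<theta>)"
    by (simp add: exp_eq_polar)
  with *(3) show "x \<in> exp ` {w. Im w \<in> I}"
    by (intro image_eqI[of _ _ "Complex (ln \<xi>) \<theta>"]) auto
next
  fix x assume "x \<in> exp ` {w. Im w \<in> I}"
  then obtain w where *: "x = exp w" "Im w \<in> I"
    by auto
  then have "x = of_real (exp (Re w)) * cis (Im w)"
    by (simp add: exp_eq_polar)
  with * show "x \<in> sector I"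
    unfolding sector_def using exp_gt_zero by blast
qed

text \<open>\<open>exp\<close> is a covering of the punctured plane, hence an open map, and the
  strip of all w with Im w \<in> I is open. The strip also handles intervals longer than 2 pi, on
  which polar coordinates are not injective.\<close>

lemma open_sector:
  assumes "open I"
  shows "open (sector I)"
proof -
  have "open {w. Im w \<in> I}"
    using assms open_vimage[OF assms, of Im] by (simp add: vimage_def continuous_on_Im)
  then have "openin (top_of_set (- {0})) (exp ` {w::complex. Im w \<in> I})"
    by (intro covering_space_open_map[OF covering_space_exp_punctured_plane]) auto
  then show ?thesis
    unfolding sector_eq_exp by (rule openin_open_trans) auto
qed

lemma connected_sector:
  assumes "is_interval I"
  shows "connected (sector I)"
proof -
  have "convex {w. Im w \<in> I}"
  proof -
    have "{w. Im w \<in> I} = Im -` I" by auto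
    then show ?thesis
      using assms by (simp add: is_interval_convex convex_linear_vimage[OF bounded_linear.linear[OF bounded_linear_Im]])
  qed
  then show ?thesis
    unfolding sector_eq_exp
    by (intro connected_continuous_image continuous_intros convex_connected)
qed

lemma ray_in_sector: "\<theta> \<in> I \<Longrightarrow> \<xi> > 0 \<Longrightarrow> of_real \<xi> * cis \<theta> \<in> sector I"
  by (auto simp: sector_def)

lemma sector_scale: "\<zeta> \<in> sector I \<Longrightarrow> t > 0 \<Longrightarrow> of_real t * \<zeta> \<in> sector I"
proof -
  assume "\<zeta> \<in> sector I" "t > 0"
  then obtain \<xi> \<theta> where "\<zeta> = of_real \<xi> * cis \<theta>" "\<xi> > 0" "\<theta> \<in> I"
    by (auto simp: sector_def)
  with \<open>t > 0\<close> ray_in_sector[of \<theta> I "t * \<xi>"] show ?thesis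
    by (simp add: mult.assoc)
qed

text \<open>Star-shapedness about 0 is what convolution along the segment from 0 to \<zeta> needs:
  both \<open>t * \<zeta>\<close> and \<open>(1 - t) * \<zeta>\<close> stay in \<open>S\<close>. It
  also yields global primitives for the rotation of contours.\<close>

locale star_open =
  fixes S :: "complex set"
  assumes open_S: "open S" and zero_S: "0 \<in> S"
    and star_S: "\<And>\<zeta> t. \<zeta> \<in> S \<Longrightarrow> 0 \<le> t \<Longrightarrow> t \<le> 1 \<Longrightarrow> of_real t * \<zeta> \<in> S"

lemma star_open_borel_domain:
  assumes "open I" "r > 0"
  shows "star_open (ball 0 r \<union> sector I)"
proof
  show "open (ball 0 r \<union> sector I)"
    using open_sector[OF assms(1)] by auto
  show "0 \<in> ball 0 r \<union> sector I"
    using assms by auto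
  fix \<zeta> :: complex and t :: real
  assume *: "\<zeta> \<in> ball 0 r \<union> sector I" "0 \<le> t" "t \<le> 1"
  show "of_real t * \<zeta> \<in> ball 0 r \<union> sector I"
  proof (cases "t = 0")
    case False
    have "norm (of_real t * \<zeta>) \<le> norm \<zeta>"
      using * by (simp add: norm_mult mult_left_le_one_le)
    with False * sector_scale[of \<zeta> I t] show ?thesis
      by auto
  qed (use assms in auto)
qed

lemma continues_to_domain:
  assumes "continues_to I \<phi> F" "open I"
  obtains r where "r > 0" "F holomorphic_on (ball 0 r \<union> sector I)"
proof -
  from assms have exp: "F has_fps_expansion \<phi>" and hol: "F holomorphic_on sector I"
    by (auto simp: continues_to_def)
  from exp obtain s where s: "open s" "0 \<in> s" "F holomorphic_on s"
    by (rule has_fps_expansion_imp_holomorphic)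
  then obtain r where "r > 0" "ball 0 r \<subseteq> s"
    using openE by blast
  with s hol open_sector[OF assms(2)] have "F holomorphic_on (ball 0 r \<union> sector I)"
    using holomorphic_on_subset[OF s(3)] holomorphic_on_Un by blast
  with \<open>r > 0\<close> show ?thesis
    by (rule that)
qed

text \<open>Both functions equal the sum of the power series near 0, and every disk about 0 meets
  the connected open set \<open>sector I\<close>. This makes the arbitrary choice in
  \<open>continuation\<close> harmless.\<close>

lemma continues_to_unique:
  assumes "continues_to I \<phi> F" "continues_to I \<phi> G" "open I" "is_interval I" "\<zeta> \<in> sector I"
  shows "F \<zeta> = G \<zeta>"
proof -
  from assms(1,2) have "\<forall>\<^sub>F z in nhds 0. eval_fps \<phi> z = F z" "\<forall>\<^sub>F z in nhds 0. eval_fps \<phi> z = G z"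
    by (auto simp: continues_to_def has_fps_expansion_def)
  then have "\<forall>\<^sub>F z in nhds 0. F z = G z"
    by eventually_elim auto
  then obtain r where r: "r > 0" "\<And>z. dist z 0 < r \<Longrightarrow> F z = G z"
    unfolding eventually_nhds_metric by blast
  from assms(5) obtain \<theta> where \<theta>: "\<theta> \<in> I"
    by (auto simp: sector_def)
  have "of_real (r/2) * cis \<theta> \<in> sector I \<inter> ball 0 r"
    using ray_in_sector[OF \<theta>, of "r/2"] r(1) by (auto simp: norm_mult)
  then have ne: "sector I \<inter> ball 0 r \<noteq> {}"
    by blast
  have op: "open (sector I \<inter> ball 0 r)"
    using open_sector[OF assms(3)] by blast
  have eq: "F z = G z" if "z \<in> sector I \<inter> ball 0 r" for z
    using that by (intro r(2)) (simp add: dist_commute)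
  have hol: "F holomorphic_on sector I" "G holomorphic_on sector I"
    using assms(1,2) by (simp_all add: continues_to_def)
  show ?thesis
    by (rule analytic_continuation_open[OF op open_sector[OF assms(3)] ne
          connected_sector[OF assms(4)] Int_lower1 hol eq assms(5)])
qed

lemma continues_to_continuation:
  assumes "continues_to I \<phi> F"
  shows "continues_to I \<phi> (continuation I \<phi>)"
  unfolding continuation_def using assms by (rule someI[of "continues_to I \<phi>"])

section \<open>Convolution on star-shaped domains\<close>

text \<open>The integral of F(\<zeta> - s) G(s) ds from 0 to \<zeta>, with s = t \<zeta>. The fixed
  interval [0, 1] turns \<zeta> into a mere parameter, so that differentiation under the integral
  sign applies.\<close>

definition conv :: "(complex \<Rightarrow> complex) \<Rightarrow> (complex \<Rightarrow> complex) \<Rightarrow> complex \<Rightarrow> complex" where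
  "conv F G \<zeta> = integral {0..1} (\<lambda>t. \<zeta> * F (of_real (1 - t) * \<zeta>) * G (of_real t * \<zeta>))"

context star_open
begin

lemma has_deriv: "F holomorphic_on S \<Longrightarrow> \<zeta> \<in> S \<Longrightarrow> (F has_field_derivative deriv F \<zeta>) (at \<zeta>)"
  using open_S holomorphic_derivI by blast

lemma star_S': "\<zeta> \<in> S \<Longrightarrow> 0 \<le> t \<Longrightarrow> t \<le> 1 \<Longrightarrow> of_real (1 - t) * \<zeta> \<in> S"
  using star_S[of \<zeta> "1 - t"] by simp

lemma continuous_on_ray:
  assumes "continuous_on S F" "U \<subseteq> S"
  shows "continuous_on (U \<times> {0..1}) (\<lambda>x. F (of_real (snd x) * fst x))"
    and "continuous_on (U \<times> {0..1}) (\<lambda>x. F (of_real (1 - snd x) * fst x))"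
proof -
  show "continuous_on (U \<times> {0..1}) (\<lambda>x. F (of_real (snd x) * fst x))"
    by (rule continuous_on_compose2[OF assms(1)])
       (use assms(2) star_S in \<open>auto intro!: continuous_intros\<close>)
  show "continuous_on (U \<times> {0..1}) (\<lambda>x. F (of_real (1 - snd x) * fst x))"
    by (rule continuous_on_compose2[OF assms(1)])
       (use assms(2) star_S' in \<open>auto intro!: continuous_intros simp del: of_real_diff\<close>)
qed

lemma continuous_on_ray_1:
  assumes "continuous_on S F" "\<zeta> \<in> S"
  shows "continuous_on {0..1} (\<lambda>t. F (of_real t * \<zeta>))"
    and "continuous_on {0..1} (\<lambda>t. F (of_real (1 - t) * \<zeta>))"
proof -
  show "continuous_on {0..1} (\<lambda>t. F (of_real t * \<zeta>))"
    by (rule continuous_on_compose2[OF assms(1)])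
       (use assms(2) star_S in \<open>auto intro!: continuous_intros\<close>)
  show "continuous_on {0..1} (\<lambda>t. F (of_real (1 - t) * \<zeta>))"
    by (rule continuous_on_compose2[OF assms(1)])
       (use assms(2) star_S' in \<open>auto intro!: continuous_intros simp del: of_real_diff\<close>)
qed

lemma conv_integrable:
  assumes "F holomorphic_on S" "G holomorphic_on S" "\<zeta> \<in> S"
  shows "(\<lambda>t. \<zeta> * F (of_real (1 - t) * \<zeta>) * G (of_real t * \<zeta>)) integrable_on {0..1}"
  by (intro integrable_continuous_real continuous_intros continuous_on_ray_1
       holomorphic_on_imp_continuous_on assms)

text \<open>
  Differentiation under the integral sign produces, besides \<open>conv (deriv F) G\<close>, the integral over
  \<open>[0, 1]\<close> of the \<open>t\<close>-derivative of \<open>t F((1 - t) \<zeta>) G(t \<zeta>)\<close>.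
\<close>
lemma conv_has_field_derivative:
  assumes F: "F holomorphic_on S" and G: "G holomorphic_on S" and z: "\<zeta> \<in> S"
  shows "(conv F G has_field_derivative (F 0 * G \<zeta> + conv (deriv F) G \<zeta>)) (at \<zeta>)"
proof -
  obtain e where e: "e > 0" "ball \<zeta> e \<subseteq> S"
    using open_S z openE by blast
  have F': "deriv F holomorphic_on S" and G': "deriv G holomorphic_on S"
    using F G open_S by (auto intro: holomorphic_deriv)
  note cont = holomorphic_on_imp_continuous_on[OF F] holomorphic_on_imp_continuous_on[OF F']
    holomorphic_on_imp_continuous_on[OF G] holomorphic_on_imp_continuous_on[OF G']
  define fx where "fx = (\<lambda>\<zeta> t. F (of_real (1 - t) * \<zeta>) * G (of_real t * \<zeta>)
     + of_real (1 - t) * \<zeta> * deriv F (of_real (1 - t) * \<zeta>) * G (of_real t * \<zeta>)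
     + of_real t * \<zeta> * F (of_real (1 - t) * \<zeta>) * deriv G (of_real t * \<zeta>))"
  have "((\<lambda>\<zeta>. integral (cbox 0 1) (\<lambda>t. \<zeta> * F (of_real (1 - t) * \<zeta>) * G (of_real t * \<zeta>)))
     has_field_derivative integral (cbox 0 1) (fx \<zeta>)) (at \<zeta> within ball \<zeta> e)"
  proof (rule leibniz_rule_field_derivative)
    fix x and t :: real
    assume x: "x \<in> ball \<zeta> e" and t: "t \<in> cbox 0 1"
    then have "x \<in> S"
      using e by auto
    have 1: "((\<lambda>x. F (of_real (1 - t) * x)) has_field_derivative deriv F (of_real (1 - t) * x) * of_real (1 - t))
         (at x within ball \<zeta> e)"
      using t \<open>x \<in> S\<close> star_S'
      by (intro DERIV_chain2[OF has_deriv[OF F]]) (auto intro!: derivative_eq_intros)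
    have 2: "((\<lambda>x. G (of_real t * x)) has_field_derivative deriv G (of_real t * x) * of_real t)
         (at x within ball \<zeta> e)"
      using t \<open>x \<in> S\<close> star_S
      by (intro DERIV_chain2[OF has_deriv[OF G]]) (auto intro!: derivative_eq_intros)
    show "((\<lambda>x. x * F (of_real (1 - t) * x) * G (of_real t * x)) has_field_derivative fx x t)
         (at x within ball \<zeta> e)"
      by (rule DERIV_cong[OF DERIV_mult[OF DERIV_mult[OF DERIV_ident 1] 2]])
         (simp add: fx_def algebra_simps)
  next
    fix x assume "x \<in> ball \<zeta> e"
    with e show "(\<lambda>t. x * F (of_real (1 - t) * x) * G (of_real t * x)) integrable_on cbox 0 1"
      using conv_integrable[OF F G] by auto
  next
    show "continuous_on (ball \<zeta> e \<times> cbox 0 1) (\<lambda>(x, t). fx x t)"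
      unfolding fx_def split_beta box_real
      by (intro continuous_intros continuous_on_ray cont e)
  qed (use e in auto)
  then have 1: "(conv F G has_field_derivative integral {0..1} (fx \<zeta>)) (at \<zeta>)"
    using e by (simp add: at_within_open[of _ "ball \<zeta> e"] conv_def[abs_def])
  have "((\<lambda>t. F (of_real (1 - t) * \<zeta>) * G (of_real t * \<zeta>)
       - of_real t * \<zeta> * deriv F (of_real (1 - t) * \<zeta>) * G (of_real t * \<zeta>)
       + of_real t * \<zeta> * F (of_real (1 - t) * \<zeta>) * deriv G (of_real t * \<zeta>))
     has_integral (of_real 1 * F (of_real (1 - 1) * \<zeta>) * G (of_real 1 * \<zeta>)
       - of_real 0 * F (of_real (1 - 0) * \<zeta>) * G (of_real 0 * \<zeta>))) {0..1}"
  proof (rule fundamental_theorem_of_calculus)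
    fix t :: real assume t: "t \<in> {0..1}"
    have 1: "((\<lambda>t. F (of_real (1 - t) * \<zeta>)) has_vector_derivative - \<zeta> * deriv F (of_real (1 - t) * \<zeta>)) (at t within {0..1})"
      by (rule has_vector_derivative_eq_rhs[OF field_vector_diff_chain_within[unfolded o_def,
            where g = F and f = "\<lambda>t. of_real (1 - t) * \<zeta>" and f' = "- \<zeta>"]])
         (use t star_S'[OF z] in \<open>auto intro!: derivative_eq_intros DERIV_subset[OF has_deriv[OF F]] has_vector_derivative_mult_left simp del: of_real_diff simp: has_vector_derivative_def scaleR_conv_of_real\<close>)
    have 2: "((\<lambda>t. G (of_real t * \<zeta>)) has_vector_derivative \<zeta> * deriv G (of_real t * \<zeta>)) (at t within {0..1})"
      by (rule has_vector_derivative_eq_rhs[OF field_vector_diff_chain_within[unfolded o_def,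
            where g = G and f = "\<lambda>t. of_real t * \<zeta>" and f' = "\<zeta>"]])
         (use t star_S[OF z] in \<open>auto intro!: derivative_eq_intros DERIV_subset[OF has_deriv[OF G]] simp: has_vector_derivative_def scaleR_conv_of_real\<close>)
    have 3: "(complex_of_real has_vector_derivative 1) (at t within {0..1})"
      by (auto intro!: derivative_eq_intros)
    show "((\<lambda>t. of_real t * F (of_real (1 - t) * \<zeta>) * G (of_real t * \<zeta>)) has_vector_derivative
       F (of_real (1 - t) * \<zeta>) * G (of_real t * \<zeta>)
       - of_real t * \<zeta> * deriv F (of_real (1 - t) * \<zeta>) * G (of_real t * \<zeta>)
       + of_real t * \<zeta> * F (of_real (1 - t) * \<zeta>) * deriv G (of_real t * \<zeta>)) (at t within {0..1})"
      by (rule has_vector_derivative_eq_rhs[OF has_vector_derivative_mult[OF has_vector_derivative_mult[OF 3 1] 2]])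
         (simp add: algebra_simps)
  qed auto
  moreover have "((\<lambda>t. \<zeta> * deriv F (of_real (1 - t) * \<zeta>) * G (of_real t * \<zeta>)) has_integral conv (deriv F) G \<zeta>) {0..1}"
    using conv_integrable[OF F' G z] by (simp add: conv_def has_integral_integral)
  ultimately have "(fx \<zeta> has_integral (F 0 * G \<zeta> + conv (deriv F) G \<zeta>)) {0..1}"
    by (rule has_integral_add[THEN has_integral_eq_rhs, THEN has_integral_eq[rotated]])
       (simp_all add: fx_def algebra_simps)
  with 1 show ?thesis
    by (metis integral_unique)
qed

lemma conv_holomorphic:
  assumes "F holomorphic_on S" "G holomorphic_on S"
  shows "conv F G holomorphic_on S"
  using conv_has_field_derivative[OF assms] open_S by (auto simp: holomorphic_on_open)

lemma conv_funpow_holomorphic: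
  assumes "F holomorphic_on S" "G holomorphic_on S"
  shows "(conv F ^^ p) G holomorphic_on S"
  by (induction p) (auto intro: assms conv_holomorphic)

lemma has_fps_expansion_if_coeffs:
  assumes "h holomorphic_on S" "\<And>n. (deriv ^^ n) h 0 / fact n = fps_nth A n"
  shows "h has_fps_expansion A"
proof -
  have *: "h has_fps_expansion fps_expansion h 0"
    using open_S zero_S assms(1) by (rule has_fps_expansion_fps_expansion)
  have "fps_expansion h 0 = A"
    by (rule fps_ext) (simp add: fps_expansion_def assms(2))
  with * show ?thesis by simp
qed

text \<open>The derivative formula for \<open>conv\<close> lowers n by one and replaces
  \<open>F\<close> by \<open>deriv F\<close>. On the formal side this is \<phi> = \<phi>_1 z^(-1) +
  z^(-1) \<phi>', whose first part accounts for the boundary term F(0) G.\<close>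

lemma conv_coeff:
  assumes "F holomorphic_on S" "G holomorphic_on S"
    and "F has_fps_expansion borel_minor \<phi>" "fps_nth \<phi> 0 = 0"
    and "G has_fps_expansion borel_minor \<psi>" "fps_nth \<psi> 0 = 0"
  shows "(deriv ^^ n) (conv F G) 0 / fact n = fps_nth (borel_minor (\<phi> * \<psi>)) n"
  using assms(1,3,4)
proof (induction n arbitrary: F \<phi>)
  case 0
  have "fps_nth (\<phi> * \<psi>) (Suc 0) = 0"
    using 0 assms(6) by (simp add: fps_mult_nth)
  then show ?case
    by (simp add: conv_def borel_minor_def)
next
  case (Suc n)
  \<comment> \<open>The Borel transform of \<phi>' is \<open>deriv F\<close>. Subtracting \<phi>_1
    gives \<phi>' the zero constant term that the induction hypothesis asks for; \<phi>_1 returns as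
    F(0).\<close>
  define \<phi>' where "\<phi>' = fps_shift 1 \<phi> - fps_const (fps_nth \<phi> 1)"
  have phi: "\<phi> = fps_const (fps_nth \<phi> 1) * fps_X + fps_X * \<phi>'"
    using Suc.prems(3) by (intro fps_ext) (auto simp: \<phi>'_def)
  have F': "deriv F holomorphic_on S"
    using Suc.prems(1) open_S by (rule holomorphic_deriv)
  have exp: "deriv F has_fps_expansion borel_minor \<phi>'"
  proof -
    have "fps_deriv (borel_minor \<phi>) = borel_minor \<phi>'"
      by (intro fps_ext) (simp add: borel_minor_def \<phi>'_def field_simps del: of_nat_Suc)
    with has_fps_expansion_deriv[OF Suc.prems(2)] show ?thesis
      by simp
  qed
  have F0: "F 0 = fps_nth \<phi> 1"
    using fps_nth_fps_expansion[OF Suc.prems(2), of 0] by (simp add: borel_minor_def)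
  define E where "E = fps_expansion (conv (deriv F) G) 0"
  have "conv (deriv F) G has_fps_expansion E"
    unfolding E_def using open_S zero_S conv_holomorphic[OF F' assms(2)] by (rule has_fps_expansion_fps_expansion)
  moreover have En: "fps_nth E n = fps_nth (borel_minor (\<phi>' * \<psi>)) n"
    using Suc.IH[OF F' exp] by (simp add: E_def fps_expansion_def \<phi>'_def)
  ultimately have *: "(\<lambda>\<zeta>. F 0 * G \<zeta> + conv (deriv F) G \<zeta>) has_fps_expansion
      fps_const (F 0) * borel_minor \<psi> + E"
    using assms(5) by (intro fps_expansion_intros)
  have "\<forall>\<^sub>F \<zeta> in nhds 0. F 0 * G \<zeta> + conv (deriv F) G \<zeta> = deriv (conv F G) \<zeta>"
    using eventually_nhds_in_open[OF open_S zero_S]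
    by eventually_elim (use conv_has_field_derivative[OF Suc.prems(1) assms(2)] DERIV_imp_deriv in force)
  then have "deriv (conv F G) has_fps_expansion fps_const (F 0) * borel_minor \<psi> + E"
    using * by (rule iffD1[OF has_fps_expansion_cong[OF _ refl]])
  from fps_nth_fps_expansion[OF this, of n]
  have "(deriv ^^ Suc n) (conv F G) 0 / fact n = (fps_nth \<phi> 1 * fps_nth \<psi> (Suc n) + fps_nth (\<phi>' * \<psi>) (Suc n)) / fact n"
    by (simp add: En F0 borel_minor_def funpow_Suc_right add_divide_distrib del: funpow.simps)
  also have "fps_nth \<phi> 1 * fps_nth \<psi> (Suc n) + fps_nth (\<phi>' * \<psi>) (Suc n) = fps_nth (\<phi> * \<psi>) (Suc (Suc n))"
    by (subst (2) phi) (simp add: algebra_simps)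
  finally show ?case
    by (simp add: borel_minor_def field_simps del: of_nat_Suc funpow.simps)
qed

lemma conv_has_fps_expansion:
  assumes "F holomorphic_on S" "G holomorphic_on S"
    and "F has_fps_expansion borel_minor \<phi>" "fps_nth \<phi> 0 = 0"
    and "G has_fps_expansion borel_minor \<psi>" "fps_nth \<psi> 0 = 0"
  shows "conv F G has_fps_expansion borel_minor (\<phi> * \<psi>)"
  using conv_coeff[OF assms] conv_holomorphic[OF assms(1,2)] by (intro has_fps_expansion_if_coeffs)

lemma conv_funpow_has_fps_expansion:
  assumes "F holomorphic_on S" "G holomorphic_on S"
    and "F has_fps_expansion borel_minor \<phi>" "fps_nth \<phi> 0 = 0"
    and "G has_fps_expansion borel_minor \<psi>" "fps_nth \<psi> 0 = 0"
  shows "(conv F ^^ p) G has_fps_expansion borel_minor (\<phi> ^ p * \<psi>)"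
proof (induction p)
  case (Suc p)
  have "conv F ((conv F ^^ p) G) has_fps_expansion borel_minor (\<phi> * (\<phi> ^ p * \<psi>))"
    using assms Suc by (intro conv_has_fps_expansion conv_funpow_holomorphic) auto
  then show ?case by (simp add: mult.assoc)
qed (use assms in simp)

end

section \<open>The composition series in the Borel plane\<close>

text \<open>The sum picks the even indices from the exponential series, whose terms are nonnegative.
  The majorant is exp rather than cosh because \<open>N_bd\<close> measures growth by a pure
  exponential.\<close>

lemma sum_even_exp_le:
  assumes "0 \<le> (x::real)"
  shows "(\<Sum>p<N. x ^ (2 * p) / fact (2 * p)) \<le> exp x"
proof -
  have "(\<Sum>p<N. x ^ (2 * p) / fact (2 * p)) = (\<Sum>k\<in>(*) 2 ` {..<N}. x ^ k / fact k)"
    by (simp add: sum.reindex inj_on_def)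
  also have "\<dots> \<le> (\<Sum>k. x ^ k / fact k)"
    using assms summable_exp[of x] by (intro sum_le_suminf) (auto simp: divide_inverse mult.commute)
  also have "\<dots> = exp x"
    by (simp add: exp_def divide_inverse mult.commute)
  finally show ?thesis .
qed

lemma summable_even_exp: "0 \<le> (x::real) \<Longrightarrow> summable (\<lambda>p. x ^ (2 * p) / fact (2 * p))"
  using sum_even_exp_le[of x]
  by (intro bounded_imp_summable[of _ "exp x"]) (auto simp flip: lessThan_Suc_atMost simp del: sum.lessThan_Suc)

text \<open>d/dz sends z^(-n-1) to -(n+1) z^(-n-2), and the factor n+1 is absorbed by the factorial
  of the Borel transform.\<close>

lemma borel_minor_dz: "fps_nth \<kappa> 0 = 0 \<Longrightarrow> borel_minor (dz \<kappa>) = - fps_X * borel_minor \<kappa>"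
  by (intro fps_ext)
     (auto simp: borel_minor_def dz_def fps_X_power_mult_nth field_simps power2_eq_square fact_reduce mult.assoc
           split: if_splits)

lemma dz_funpow_nth_0: "fps_nth \<kappa> 0 = 0 \<Longrightarrow> fps_nth ((dz ^^ p) \<kappa>) 0 = 0"
  by (cases p) (auto simp: dz_def fps_X_power_mult_nth)

lemma borel_minor_dz_funpow: "fps_nth \<kappa> 0 = 0 \<Longrightarrow> borel_minor ((dz ^^ p) \<kappa>) = (- fps_X) ^ p * borel_minor \<kappa>"
  by (induction p) (auto simp: borel_minor_dz dz_funpow_nth_0)

lemma borel_minor_cmult: "borel_minor (fps_const c * \<phi>) = fps_const c * borel_minor \<phi>"
  by (intro fps_ext) (simp add: borel_minor_def)

lemma borel_minor_const_add: "borel_minor (fps_const c + \<phi>) = borel_minor \<phi>"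
  by (intro fps_ext) (simp add: borel_minor_def)

text \<open>
  If \<open>F\<close>, \<open>K\<close> are the Borel transforms of \<open>\<phi>\<close>, \<open>\<kappa>\<close>, this is the Borel transform of \<open>\<phi>\<^sup>p/p! \<cdot> (d/dz)\<^sup>p \<kappa>\<close>.
\<close>
definition comp_term :: "(complex \<Rightarrow> complex) \<Rightarrow> (complex \<Rightarrow> complex) \<Rightarrow> nat \<Rightarrow> complex \<Rightarrow> complex" where
  "comp_term F K p = (conv F ^^ p) (\<lambda>\<zeta>. (- \<zeta>) ^ p / fact p * K \<zeta>)"

definition comp_series :: "(complex \<Rightarrow> complex) \<Rightarrow> (complex \<Rightarrow> complex) \<Rightarrow> complex \<Rightarrow> complex" where
  "comp_series F K \<zeta> = (\<Sum>p. comp_term F K p \<zeta>)"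

context star_open
begin

text \<open>The exponentials at (1 - t) s and t s multiply to exp(c s), and what remains is the
  integral of t^n over [0, 1], namely 1/(n+1). The form with \<open>norm u \<le> 1\<close> and a
  finite segment serves both true directions and all points of a ball, rescaled to a common
  length.\<close>

lemma conv_bound:
  assumes F: "F holomorphic_on S" and G: "G holomorphic_on S" and u: "norm u \<le> 1"
    and ray: "of_real \<xi> * u \<in> S"
    and Fb: "\<And>s. 0 \<le> s \<Longrightarrow> s \<le> \<xi> \<Longrightarrow> norm (F (of_real s * u)) \<le> A * exp (c * s)"
    and Gb: "\<And>s. 0 \<le> s \<Longrightarrow> s \<le> \<xi> \<Longrightarrow> norm (G (of_real s * u)) \<le> B * s ^ n / fact n * exp (c * s)"
    and s: "0 \<le> s" "s \<le> \<xi>"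
  shows "norm (conv F G (of_real s * u)) \<le> A * B * s ^ Suc n / fact (Suc n) * exp (c * s)"
proof (cases "s = 0")
  case True
  then show ?thesis by (simp add: conv_def)
next
  case False
  then have "s > 0" using s by simp
  have sS: "of_real s * u \<in> S"
    using star_S[OF ray, of "s / \<xi>"] s \<open>s > 0\<close> by (simp add: field_simps)
  have "norm (integral {0..1} (\<lambda>t. (of_real s * u) * F (of_real (1 - t) * (of_real s * u)) * G (of_real t * (of_real s * u))))
     \<le> integral {0..1} (\<lambda>t. A * B * s ^ Suc n / fact n * exp (c * s) * t ^ n)"
  proof (rule integral_norm_bound_integral)
    show "(\<lambda>t. of_real s * u * F (of_real (1 - t) * (of_real s * u)) * G (of_real t * (of_real s * u))) integrable_on {0..1}"
      by (rule conv_integrable[OF F G sS])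
    show "(\<lambda>t. A * B * s ^ Suc n / fact n * exp (c * s) * t ^ n) integrable_on {0..1}"
      by (intro integrable_continuous_real continuous_intros)
    fix t :: real assume t: "t \<in> {0..1}"
    have 1: "norm (F (of_real (s * (1 - t)) * u)) \<le> A * exp (c * (s * (1 - t)))"
      using t s mult_left_le[of "1 - t" s] by (intro Fb) auto
    have 2: "norm (G (of_real (s * t) * u)) \<le> B * (s * t) ^ n / fact n * exp (c * (s * t))"
      using t s mult_left_le[of t s] by (intro Gb) auto
    have "norm (of_real s * u * F (of_real (1 - t) * (of_real s * u)) * G (of_real t * (of_real s * u)))
       = s * norm u * norm (F (of_real (s * (1 - t)) * u)) * norm (G (of_real (s * t) * u))"
      using s by (simp add: norm_mult mult_ac)
    also have "\<dots> \<le> s * 1 * (A * exp (c * (s * (1 - t)))) * (B * (s * t) ^ n / fact n * exp (c * (s * t)))"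
      using s u order_trans[OF norm_ge_zero 1]
      by (intro mult_mono 1 2 mult_nonneg_nonneg) (auto simp: zero_le_mult_iff)
    also have "\<dots> = A * B * s ^ Suc n / fact n * (exp (c * (s * (1 - t))) * exp (c * (s * t))) * t ^ n"
      by (simp add: power_mult_distrib field_simps)
    also have "exp (c * (s * (1 - t))) * exp (c * (s * t)) = exp (c * s)"
      by (simp add: exp_add[symmetric] algebra_simps)
    finally show "norm (of_real s * u * F (of_real (1 - t) * (of_real s * u)) * G (of_real t * (of_real s * u)))
        \<le> A * B * s ^ Suc n / fact n * exp (c * s) * t ^ n" .
  qed
  also have "\<dots> = A * B * s ^ Suc n / fact n * exp (c * s) * (1 / real (Suc n))"
  proof -
    have "((\<lambda>t::real. t ^ n) has_integral 1 / real (Suc n)) {0..1}"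
      by (rule has_integral_eq_rhs, rule fundamental_theorem_of_calculus[where f = "\<lambda>t. t ^ Suc n / real (Suc n)"])
         (auto simp: field_simps has_real_derivative_iff_has_vector_derivative[symmetric] intro!: derivative_eq_intros simp del: of_nat_Suc power_Suc)
    then show ?thesis
      by (simp add: integral_unique)
  qed
  finally show ?thesis
    unfolding conv_def by (simp add: field_simps)
qed

lemma conv_funpow_bound:
  assumes F: "F holomorphic_on S" and G: "G holomorphic_on S" and u: "norm u \<le> 1"
    and ray: "of_real \<xi> * u \<in> S"
    and Fb: "\<And>s. 0 \<le> s \<Longrightarrow> s \<le> \<xi> \<Longrightarrow> norm (F (of_real s * u)) \<le> A * exp (c * s)"
    and Gb: "\<And>s. 0 \<le> s \<Longrightarrow> s \<le> \<xi> \<Longrightarrow> norm (G (of_real s * u)) \<le> B * s ^ n / fact n * exp (c * s)"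
    and s: "0 \<le> s" "s \<le> \<xi>"
  shows "norm ((conv F ^^ k) G (of_real s * u)) \<le> A ^ k * B * s ^ (n + k) / fact (n + k) * exp (c * s)"
  using s
proof (induction k arbitrary: s)
  case (Suc k)
  then show ?case
    using conv_bound[OF F conv_funpow_holomorphic[OF F G] u ray Fb, of k "A ^ k * B" "n + k" s]
    by (simp add: mult_ac del: fact_Suc)
qed (use Gb in simp)

lemma comp_term_holomorphic:
  assumes F: "F holomorphic_on S" and K: "K holomorphic_on S"
  shows "comp_term F K p holomorphic_on S"
  unfolding comp_term_def
  by (intro conv_funpow_holomorphic F holomorphic_intros K) auto

text \<open>The convolution estimate starts at n = p with the weight s^p/p! and is applied p times.
  It ends at s^(2p)/(2p)! with the factor A^p = sqrt(A)^(2p).\<close>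

lemma comp_term_bound:
  assumes F: "F holomorphic_on S" and K: "K holomorphic_on S" and u: "norm u \<le> 1"
    and ray: "of_real \<xi> * u \<in> S" and A: "0 \<le> A"
    and Fb: "\<And>s. 0 \<le> s \<Longrightarrow> s \<le> \<xi> \<Longrightarrow> norm (F (of_real s * u)) \<le> A * exp (c * s)"
    and Kb: "\<And>s. 0 \<le> s \<Longrightarrow> s \<le> \<xi> \<Longrightarrow> norm (K (of_real s * u)) \<le> B * exp (c * s)"
    and s: "0 \<le> s" "s \<le> \<xi>"
  shows "norm (comp_term F K p (of_real s * u)) \<le> B * exp (c * s) * ((sqrt A * s) ^ (2 * p) / fact (2 * p))"
proof -
  have "norm (comp_term F K p (of_real s * u)) \<le> A ^ p * B * s ^ (p + p) / fact (p + p) * exp (c * s)"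
    unfolding comp_term_def
  proof (rule conv_funpow_bound[OF F _ u ray Fb _ s])
    show "(\<lambda>\<zeta>. (- \<zeta>) ^ p / fact p * K \<zeta>) holomorphic_on S"
      by (intro holomorphic_intros K) auto
    fix s :: real assume s: "0 \<le> s" "s \<le> \<xi>"
    have "norm ((- (of_real s * u)) ^ p / fact p * K (of_real s * u)) = (s * norm u) ^ p / fact p * norm (K (of_real s * u))"
      using s by (simp add: norm_mult norm_divide norm_power)
    also have "\<dots> \<le> s ^ p / fact p * (B * exp (c * s))"
      using s u Kb[OF s] by (intro mult_mono divide_right_mono power_mono) (auto simp: mult_left_le)
    finally show "norm ((- (of_real s * u)) ^ p / fact p * K (of_real s * u)) \<le> B * s ^ p / fact p * exp (c * s)"
      by (simp add: mult_ac)
  qed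
  also have "\<dots> = B * exp (c * s) * ((sqrt A * s) ^ (2 * p) / fact (2 * p))"
  proof -
    have "(sqrt A * s) ^ (2 * p) = A ^ p * s ^ (p + p)"
      using A by (simp add: power_mult_distrib power_mult[of "sqrt A"] mult_2[symmetric] del: mult_2)
    moreover have "p + p = 2 * p"
      by simp
    ultimately show ?thesis
      by (simp only: times_divide_eq_right mult_ac)
  qed
  finally show ?thesis .
qed

lemma comp_series_uniform:
  assumes F: "F holomorphic_on S" and K: "K holomorphic_on S" and z: "\<zeta> \<in> S"
  obtains d where "d > 0" "cball \<zeta> d \<subseteq> S"
    "uniform_limit (cball \<zeta> d) (\<lambda>N \<zeta>. \<Sum>p<N. comp_term F K p \<zeta>) (comp_series F K) sequentially"
proof -
  obtain d where d: "d > 0" "cball \<zeta> d \<subseteq> S"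
    using open_S z open_contains_cball by blast
  \<comment> \<open>All values of \<open>F\<close> and \<open>K\<close> that enter
    \<open>comp_term\<close> at points of the closed ball are taken on segments towards 0. These
    sweep out a compact subset of \<open>S\<close>, on which both functions are bounded.\<close>
  define H where "H = (\<lambda>x. of_real (snd x) * fst x) ` (cball \<zeta> d \<times> {0..1::real})"
  have "compact H"
    unfolding H_def by (intro compact_continuous_image continuous_intros compact_Times) auto
  moreover have HS: "H \<subseteq> S"
    using d(2) star_S by (auto simp: H_def)
  ultimately have "bounded (F ` H)" "bounded (K ` H)"
    using F K by (auto intro!: compact_imp_bounded compact_continuous_image
        intro: continuous_on_subset holomorphic_on_imp_continuous_on)
  then obtain A B where AB: "\<And>x. x \<in> H \<Longrightarrow> norm (F x) \<le> A" "\<And>x. x \<in> H \<Longrightarrow> norm (K x) \<le> B"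
    unfolding bounded_iff by auto
  have A: "0 \<le> A"
  proof -
    have "\<zeta> \<in> H"
      unfolding H_def by (rule image_eqI[of _ _ "(\<zeta>, 1)"]) (use d in auto)
    then show ?thesis
      using AB(1) norm_ge_zero order_trans by blast
  qed
  define R where "R = norm \<zeta> + d"
  have R: "R > 0"
    using d(1) by (simp add: R_def add_nonneg_pos)
  have bd: "norm (comp_term F K p x) \<le> B * ((sqrt A * R) ^ (2 * p) / fact (2 * p))" if x: "x \<in> cball \<zeta> d" for p x
  proof -
    have "norm x \<le> R"
      using x norm_triangle_sub[of x \<zeta>] by (auto simp: R_def dist_norm norm_minus_commute)
    have eq: "of_real R * (x / of_real R) = x"
      using R by simp
    have inH: "of_real s * (x / of_real R) \<in> H" if "0 \<le> s" "s \<le> R" for s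
      unfolding H_def by (rule image_eqI[of _ _ "(x, s / R)"]) (use that x R in auto)
    \<comment> \<open>The point x is R times a vector of norm at most 1, and constant bounds are
      exponential bounds of rate 0.\<close>
    have "norm (comp_term F K p (of_real R * (x / of_real R))) \<le> B * exp (0 * R) * ((sqrt A * R) ^ (2 * p) / fact (2 * p))"
    proof (rule comp_term_bound[OF F K _ _ A])
      show "norm (x / of_real R) \<le> 1"
        using \<open>norm x \<le> R\<close> R by (simp add: norm_divide)
      show "of_real R * (x / of_real R) \<in> S"
        unfolding eq using x d by auto
    qed (use AB inH R in auto)
    then show ?thesis
      unfolding eq by simp
  qed
  have "uniform_limit (cball \<zeta> d) (\<lambda>N x. \<Sum>p<N. comp_term F K p x) (\<lambda>x. \<Sum>p. comp_term F K p x) sequentially"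
    by (rule Weierstrass_m_test[OF bd]) (use A R in \<open>auto intro!: summable_mult summable_even_exp simp del: times_divide_eq_right\<close>)
  with d show ?thesis
    by (intro that) (auto simp: comp_series_def[abs_def])
qed

lemma comp_series_holomorphic:
  assumes "F holomorphic_on S" "K holomorphic_on S"
  shows "comp_series F K holomorphic_on S"
proof (rule holomorphic_uniform_sequence[OF open_S])
  show "(\<lambda>\<zeta>. \<Sum>p<N. comp_term F K p \<zeta>) holomorphic_on S" for N
    by (intro holomorphic_intros comp_term_holomorphic assms)
  fix \<zeta> assume "\<zeta> \<in> S"
  from comp_series_uniform[OF assms this]
  show "\<exists>d. 0 < d \<and> cball \<zeta> d \<subseteq> S \<and>
      uniform_limit (cball \<zeta> d) (\<lambda>N \<zeta>. \<Sum>p<N. comp_term F K p \<zeta>) (comp_series F K) sequentially"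
    by blast
qed

lemma comp_term_has_fps_expansion:
  assumes "F holomorphic_on S" "K holomorphic_on S"
    and "F has_fps_expansion borel_minor \<phi>" "fps_nth \<phi> 0 = 0"
    and "K has_fps_expansion borel_minor \<kappa>" "fps_nth \<kappa> 0 = 0"
  shows "comp_term F K p has_fps_expansion borel_minor (fps_const (1 / fact p) * \<phi> ^ p * (dz ^^ p) \<kappa>)"
proof -
  have "(\<lambda>\<zeta>. (1 / fact p) * (- \<zeta>) ^ p * K \<zeta>) has_fps_expansion
      fps_const (1 / fact p) * (- fps_X) ^ p * borel_minor \<kappa>"
    by (intro fps_expansion_intros assms)
  then have "(\<lambda>\<zeta>. (- \<zeta>) ^ p / fact p * K \<zeta>) has_fps_expansion borel_minor (fps_const (1 / fact p) * (dz ^^ p) \<kappa>)"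
    using assms(6) by (simp add: borel_minor_cmult borel_minor_dz_funpow mult.assoc)
  then have "comp_term F K p has_fps_expansion borel_minor (\<phi> ^ p * (fps_const (1 / fact p) * (dz ^^ p) \<kappa>))"
    unfolding comp_term_def using assms(2,6)
    by (intro conv_funpow_has_fps_expansion assms holomorphic_intros) (auto simp: dz_funpow_nth_0)
  then show ?thesis
    by (simp add: mult_ac)
qed

text \<open>Locally uniform convergence lets the n-th derivative at 0 pass to the limit. For the
  partial sums this derivative is the coefficient of index \<open>Suc n\<close> of the formal
  partial sums, which is eventually constant; so the analytic and the formal limit agree.\<close>

lemma comp_series_has_fps_expansion:
  assumes F: "F holomorphic_on S" and K: "K holomorphic_on S"
    and "F has_fps_expansion borel_minor \<phi>" "fps_nth \<phi> 0 = 0"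
    and "K has_fps_expansion borel_minor \<kappa>" "fps_nth \<kappa> 0 = 0"
    and \<omega>: "\<And>n. \<forall>\<^sub>F N in sequentially.
      (\<Sum>p<N. fps_nth (fps_const (1 / fact p) * \<phi> ^ p * (dz ^^ p) \<kappa>) n) = fps_nth \<omega> n"
  shows "comp_series F K has_fps_expansion borel_minor \<omega>"
proof (rule has_fps_expansion_if_coeffs)
  show "comp_series F K holomorphic_on S"
    by (rule comp_series_holomorphic[OF F K])
  fix n
  obtain d where d: "d > 0" "cball 0 d \<subseteq> S"
    "uniform_limit (cball 0 d) (\<lambda>N \<zeta>. \<Sum>p<N. comp_term F K p \<zeta>) (comp_series F K) sequentially"
    using comp_series_uniform[OF F K zero_S] .
  have "uniform_limit (ball 0 d) (\<lambda>N \<zeta>. \<Sum>p<N. comp_term F K p \<zeta>) (comp_series F K) sequentially"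
    using d(3) by (rule uniform_limit_on_subset) auto
  moreover have "comp_term F K p holomorphic_on ball 0 d" for p
    using comp_term_holomorphic[OF F K] by (rule holomorphic_on_subset) (use d(2) in auto)
  ultimately have "(\<lambda>N. (deriv ^^ n) (\<lambda>\<zeta>. \<Sum>p<N. comp_term F K p \<zeta>) 0) \<longlonglongrightarrow> (deriv ^^ n) (comp_series F K) 0"
    using d(1) by (intro higher_deriv_complex_uniform_limit[where A = "ball 0 d"] always_eventually allI holomorphic_on_sum) auto
  moreover have "(deriv ^^ n) (\<lambda>\<zeta>. \<Sum>p<N. comp_term F K p \<zeta>) 0 =
      fact n * (\<Sum>p<N. fps_nth (borel_minor (fps_const (1 / fact p) * \<phi> ^ p * (dz ^^ p) \<kappa>)) n)" for N
  proof -
    have "(\<lambda>\<zeta>. \<Sum>p<N. comp_term F K p \<zeta>) has_fps_expansion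
        (\<Sum>p<N. borel_minor (fps_const (1 / fact p) * \<phi> ^ p * (dz ^^ p) \<kappa>))"
      by (intro has_fps_expansion_sum comp_term_has_fps_expansion assms)
    from fps_nth_fps_expansion[OF this, of n] show ?thesis
      by (simp add: fps_sum_nth)
  qed
  then have "(deriv ^^ n) (\<lambda>\<zeta>. \<Sum>p<N. comp_term F K p \<zeta>) 0 =
      (\<Sum>p<N. fps_nth (fps_const (1 / fact p) * \<phi> ^ p * (dz ^^ p) \<kappa>) (Suc n))" for N
    by (simp add: borel_minor_def sum_divide_distrib[symmetric])
  ultimately have "(\<lambda>N. (\<Sum>p<N. fps_nth (fps_const (1 / fact p) * \<phi> ^ p * (dz ^^ p) \<kappa>) (Suc n)))
       \<longlonglongrightarrow> (deriv ^^ n) (comp_series F K) 0"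
    by simp
  moreover have "(\<lambda>N. (\<Sum>p<N. fps_nth (fps_const (1 / fact p) * \<phi> ^ p * (dz ^^ p) \<kappa>) (Suc n)))
       \<longlonglongrightarrow> fps_nth \<omega> (Suc n)"
    using \<omega>[of "Suc n"] by (rule tendsto_eventually)
  ultimately have "(deriv ^^ n) (comp_series F K) 0 = fps_nth \<omega> (Suc n)"
    by (rule LIMSEQ_unique)
  then show "(deriv ^^ n) (comp_series F K) 0 / fact n = fps_nth (borel_minor \<omega>) n"
    by (simp add: borel_minor_def)
qed

end

section \<open>Formal composition\<close>

lemma dz_add: "dz (a + b) = dz a + dz b"
  by (simp add: dz_def algebra_simps)

lemma dz_cmult: "dz (fps_const c * a) = fps_const c * dz a"
  by (simp add: dz_def mult_ac)

lemma dz_const: "dz (fps_const c) = 0"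
  by (simp add: dz_def)

lemma dz_funpow_add: "(dz ^^ p) (a + b) = (dz ^^ p) a + (dz ^^ p) b"
  by (induction p) (auto simp: dz_add)

lemma dz_funpow_cmult: "(dz ^^ p) (fps_const c * a) = fps_const c * (dz ^^ p) a"
  by (induction p) (auto simp: dz_cmult)

lemma dz_funpow_0: "(dz ^^ p) 0 = 0"
  by (induction p) (auto simp: dz_def)

lemma dz_funpow_sum: "(dz ^^ p) (\<Sum>i\<in>A. a i) = (\<Sum>i\<in>A. (dz ^^ p) (a i))"
  by (induction A rule: infinite_finite_induct) (auto simp: dz_funpow_0 dz_funpow_add)

text \<open>\<open>dz\<close> raises the order in \<open>fps_X\<close>, so coefficients up to n
  never depend on later ones. A formal sum may thus be truncated at order n before it is
  differentiated.\<close>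

lemma dz_funpow_nth_cong:
  assumes "\<And>m. m \<le> n \<Longrightarrow> fps_nth a m = fps_nth b m" "m \<le> n"
  shows "fps_nth ((dz ^^ p) a) m = fps_nth ((dz ^^ p) b) m"
  using assms(2)
proof (induction p arbitrary: m)
  case (Suc p)
  have "m - 2 + 1 = m - 1" if "\<not> m < 2"
    using that by simp
  with Suc.IH[of "m - 1"] Suc.prems show ?case
    by (auto simp: dz_def[of "(dz ^^ p) _"] fps_X_power_mult_nth simp del: One_nat_def)
qed (use assms in simp)

text \<open>The substitution \<kappa>(z + \<psi>(z)) by Taylor's formula. The sum may stop at n
  because the p-th derivative has order at least p in z^(-1).\<close>

definition comp_fps :: "complex fps \<Rightarrow> complex fps \<Rightarrow> complex fps" where
  "comp_fps \<psi> \<kappa> = Abs_fps (\<lambda>n. \<Sum>p\<le>n. fps_nth (fps_const (1 / fact p) * \<psi> ^ p * (dz ^^ p) \<kappa>) n)"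

lemma tang_comp_eq: "tang_comp \<phi> \<psi> = \<psi> + comp_fps \<psi> \<phi>"
  using sums_unique[OF tang_comp_sums[of \<psi> \<phi>]] by (simp add: tang_comp_def comp_fps_def)

lemma comp_fps_term_eq_0:
  assumes "n < p"
  shows "fps_nth (a * (dz ^^ p) \<kappa>) n = 0"
  unfolding fps_mult_nth by (intro sum.neutral) (use assms dz_funpow_nth_eq_0 in auto)

lemma comp_fps_nth:
  assumes "n < N"
  shows "(\<Sum>p<N. fps_nth (fps_const (1 / fact p) * \<psi> ^ p * (dz ^^ p) \<kappa>) n) = fps_nth (comp_fps \<psi> \<kappa>) n"
  unfolding comp_fps_def fps_nth_Abs_fps
  by (rule sum.mono_neutral_right) (use assms comp_fps_term_eq_0 in auto)

lemma comp_fps_add: "comp_fps \<psi> (a + b) = comp_fps \<psi> a + comp_fps \<psi> b"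
  by (intro fps_ext) (simp add: comp_fps_def dz_funpow_add distrib_left sum.distrib)

lemma comp_fps_const: "comp_fps \<psi> (fps_const c) = fps_const c"
proof (intro fps_ext)
  fix n
  have "(dz ^^ p) (fps_const c) = 0" if "p > 0" for p
    using that by (cases p) (auto simp: funpow_Suc_right dz_const dz_funpow_0 simp del: funpow.simps)
  then have "fps_nth (comp_fps \<psi> (fps_const c)) n = (\<Sum>p\<le>n. if p = 0 then fps_nth (fps_const c) n else 0)"
    unfolding comp_fps_def fps_nth_Abs_fps by (intro sum.cong) auto
  then show "fps_nth (comp_fps \<psi> (fps_const c)) n = fps_nth (fps_const c) n"
    by simp
qed

lemma comp_fps_nth_0:
  assumes "fps_nth \<kappa> 0 = 0"
  shows "fps_nth (comp_fps \<psi> \<kappa>) 0 = 0"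
  using assms by (simp add: comp_fps_def)

text \<open>The binomial theorem splits (\<sigma> + \<phi>)^p/p!, and p = q + r separates the two
  substitutions. This is Taylor's formula at z + \<sigma>; it removes \<sigma> from the powers that
  become convolutions.\<close>

lemma comp_fps_add_const: "comp_fps (fps_const \<sigma> + \<phi>) \<kappa> = comp_fps \<phi> (comp_fps (fps_const \<sigma>) \<kappa>)"
proof (intro fps_ext)
  fix n
  define t where "t q r = fps_nth (fps_const (1 / fact q) * \<phi> ^ q * fps_const (\<sigma> ^ r / fact r) * (dz ^^ (q + r)) \<kappa>) n" for q r
  have t0: "t q r = 0" if "n < q + r" for q r
    unfolding t_def using that by (rule comp_fps_term_eq_0)
  have L: "fps_const (1 / fact p) * (fps_const \<sigma> + \<phi>) ^ p * (dz ^^ p) \<kappa>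
       = (\<Sum>q\<le>p. fps_const (1 / fact q) * \<phi> ^ q * fps_const (\<sigma> ^ (p - q) / fact (p - q)) * (dz ^^ p) \<kappa>)" for p
  proof -
    have "fps_const (1 / fact p) * (fps_const \<sigma> + \<phi>) ^ p
       = (\<Sum>q\<le>p. fps_const (1 / fact p) * (of_nat (p choose q) * \<phi> ^ q * fps_const (\<sigma> ^ (p - q))))"
      by (simp add: add.commute[of _ \<phi>] binomial_ring sum_distrib_left)
    also have "\<dots> = (\<Sum>q\<le>p. fps_const (1 / fact q) * \<phi> ^ q * fps_const (\<sigma> ^ (p - q) / fact (p - q)))"
    proof (rule sum.cong)
      fix q assume "q \<in> {..p}"
      then have c: "1 / fact p * of_nat (p choose q) = (1 / fact q * (1 / fact (p - q)) :: complex)"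
        by (simp add: binomial_fact)
      have "fps_const (1 / fact p) * (of_nat (p choose q) * \<phi> ^ q * fps_const (\<sigma> ^ (p - q)))
         = fps_const (1 / fact p * of_nat (p choose q)) * (\<phi> ^ q * fps_const (\<sigma> ^ (p - q)))"
        by (simp only: fps_of_nat[symmetric] fps_const_mult[symmetric] mult_ac)
      also have "\<dots> = fps_const (1 / fact q) * \<phi> ^ q * (fps_const (1 / fact (p - q)) * fps_const (\<sigma> ^ (p - q)))"
        unfolding c fps_const_mult[symmetric] by (simp only: mult_ac)
      finally show "fps_const (1 / fact p) * (of_nat (p choose q) * \<phi> ^ q * fps_const (\<sigma> ^ (p - q)))
         = fps_const (1 / fact q) * \<phi> ^ q * fps_const (\<sigma> ^ (p - q) / fact (p - q))"
        by simp
    qed simp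
    finally show ?thesis
      by (simp add: sum_distrib_right)
  qed
  have "fps_nth (comp_fps (fps_const \<sigma> + \<phi>) \<kappa>) n = (\<Sum>p\<le>n. \<Sum>q\<le>p. t q (p - q))"
    unfolding comp_fps_def fps_nth_Abs_fps L fps_sum_nth t_def
    by (intro sum.cong) auto
  also have "\<dots> = (\<Sum>(q, r)\<in>{(q, r). q + r \<le> n}. t q r)"
    by (simp add: sum.triangle_reindex_eq)
  \<comment> \<open>Terms with q + r > n have no coefficient of index n, so the triangle may be
    filled up to a square.\<close>
  also have "\<dots> = (\<Sum>(q, r)\<in>{..n} \<times> {..n}. t q r)"
    by (rule sum.mono_neutral_left) (auto intro!: t0)
  also have "\<dots> = (\<Sum>q\<le>n. \<Sum>r\<le>n. t q r)"
    by (simp add: sum.cartesian_product)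
  also have "\<dots> = (\<Sum>q\<le>n. fps_nth (fps_const (1 / fact q) * \<phi> ^ q * (dz ^^ q) (comp_fps (fps_const \<sigma>) \<kappa>)) n)"
  proof (rule sum.cong[OF refl])
    fix q
    define \<kappa>' where "\<kappa>' = (\<Sum>r\<le>n. fps_const (1 / fact r) * fps_const \<sigma> ^ r * (dz ^^ r) \<kappa>)"
    have \<kappa>': "fps_nth (comp_fps (fps_const \<sigma>) \<kappa>) m = fps_nth \<kappa>' m" if "m \<le> n" for m
      using comp_fps_nth[of m "Suc n" "fps_const \<sigma>" \<kappa>] that
      by (simp add: \<kappa>'_def fps_sum_nth lessThan_Suc_atMost del: fps_const_power)
    have "fps_nth (fps_const (1 / fact q) * \<phi> ^ q * (dz ^^ q) (comp_fps (fps_const \<sigma>) \<kappa>)) n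
       = fps_nth (fps_const (1 / fact q) * \<phi> ^ q * (dz ^^ q) \<kappa>') n"
      unfolding fps_mult_nth[of "fps_const (1 / fact q) * \<phi> ^ q"]
      by (intro sum.cong refl arg_cong2[where f = "(*)"] dz_funpow_nth_cong[OF \<kappa>']) auto
    also have "(dz ^^ q) \<kappa>' = (\<Sum>r\<le>n. fps_const (\<sigma> ^ r / fact r) * (dz ^^ (q + r)) \<kappa>)"
      by (simp add: \<kappa>'_def dz_funpow_sum dz_funpow_cmult funpow_add)
    finally show "(\<Sum>r\<le>n. t q r) =
        fps_nth (fps_const (1 / fact q) * \<phi> ^ q * (dz ^^ q) (comp_fps (fps_const \<sigma>) \<kappa>)) n"
      by (simp add: t_def sum_distrib_left fps_sum_nth mult.assoc)
  qed
  finally show "fps_nth (comp_fps (fps_const \<sigma> + \<phi>) \<kappa>) n = fps_nth (comp_fps \<phi> (comp_fps (fps_const \<sigma>) \<kappa>)) n"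
    by (simp add: comp_fps_def)
qed

text \<open>In the Borel plane the p-th derivative is multiplication by (-\<zeta>)^p, so translation
  by \<sigma> becomes the exponential series in -\<sigma> \<zeta>.\<close>

lemma borel_minor_comp_fps_const:
  assumes "fps_nth \<kappa> 0 = 0"
  shows "borel_minor (comp_fps (fps_const \<sigma>) \<kappa>) = fps_exp (- \<sigma>) * borel_minor \<kappa>"
proof (intro fps_ext)
  fix n
  have X: "(- fps_X :: complex fps) ^ p = fps_const ((- 1) ^ p) * fps_X ^ p" for p :: nat
    by (cases "even p") auto
  have "fps_nth (borel_minor (comp_fps (fps_const \<sigma>) \<kappa>)) n
     = (\<Sum>p\<le>Suc n. fps_nth (fps_const (\<sigma> ^ p / fact p) * (dz ^^ p) \<kappa>) (Suc n) / fact n)"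
    by (simp add: borel_minor_def comp_fps_def sum_divide_distrib del: sum.atMost_Suc)
  also have "\<dots> = (\<Sum>p\<le>Suc n. \<sigma> ^ p / fact p * fps_nth (borel_minor ((dz ^^ p) \<kappa>)) n)"
    by (simp add: borel_minor_def del: sum.atMost_Suc)
  \<comment> \<open>Coefficient n of the Borel transform is coefficient n+1 of the series, so p runs
    up to n+1. The last term vanishes, being the coefficient n of a multiple of
    \<zeta>^(n+1).\<close>
  also have "\<dots> = (\<Sum>p\<le>Suc n. if n < p then 0 else (- \<sigma>) ^ p / fact p * fps_nth (borel_minor \<kappa>) (n - p))"
    by (intro sum.cong refl)
       (auto simp: borel_minor_dz_funpow[OF assms] X power_minus[of \<sigma>] mult.assoc fps_X_power_mult_nth)
  also have "\<dots> = (\<Sum>p\<le>n. (- \<sigma>) ^ p / fact p * fps_nth (borel_minor \<kappa>) (n - p))"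
    by (auto intro: sum.cong)
  finally show "fps_nth (borel_minor (comp_fps (fps_const \<sigma>) \<kappa>)) n = fps_nth (fps_exp (- \<sigma>) * borel_minor \<kappa>) n"
    by (simp add: fps_mult_nth atLeast0AtMost)
qed

lemma tang_comp_decomp:
  "tang_comp (fps_const \<tau> + \<eta>) (fps_const \<sigma> + \<phi>) =
     fps_const (\<sigma> + \<tau>) + (\<phi> + comp_fps \<phi> (comp_fps (fps_const \<sigma>) \<eta>))"
  by (simp add: tang_comp_eq comp_fps_add comp_fps_const comp_fps_add_const flip: fps_const_add)

section \<open>Laplace transforms along a ray\<close>

lemma exp_decay_integrable:
  assumes "0 < (d::real)"
  shows "set_integrable lborel {0<..} (\<lambda>x. exp (- d * x))"
    and "(LINT x:{0<..}|lborel. exp (- d * x)) = 1 / d"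
proof -
  have "((\<lambda>x. - exp (- d * x) / d) \<longlongrightarrow> 0) at_top"
    using assms by real_asymp
  then have "(\<integral>\<^sup>+x. ennreal (exp (- d * x)) * indicator {0..} x \<partial>lborel) = 0 - (- exp (- d * 0) / d)"
    using assms by (intro nn_integral_FTC_atLeast[where F = "\<lambda>x. - exp (- d * x) / d"]) (auto intro!: derivative_eq_intros)
  also have "(\<integral>\<^sup>+x. ennreal (exp (- d * x)) * indicator {0..} x \<partial>lborel) = (\<integral>\<^sup>+x. ennreal (indicator {0<..} x *\<^sub>R exp (- d * x)) \<partial>lborel)"
    by (intro nn_integral_cong_AE eventually_mono[OF AE_lborel_singleton[of 0]]) (auto simp: indicator_def)
  finally have *: "(\<integral>\<^sup>+x. ennreal (indicator {0<..} x *\<^sub>R exp (- d * x)) \<partial>lborel) = ennreal (1 / d)"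
    by simp
  have "has_bochner_integral lborel (\<lambda>x. indicator {0<..} x *\<^sub>R exp (- d * x)) (1 / d)"
    using assms by (intro has_bochner_integral_nn_integral *) auto
  then show "set_integrable lborel {0<..} (\<lambda>x. exp (- d * x))"
    and "(LINT x:{0<..}|lborel. exp (- d * x)) = 1 / d"
    by (auto simp: set_integrable_def set_lebesgue_integral_def has_bochner_integral_iff)
qed

text \<open>The integral of \<open>dir_sum\<close> for an arbitrary function instead of a
  \<open>continuation\<close>, so that it applies to each convolution term separately.\<close>

definition lap :: "(complex \<Rightarrow> complex) \<Rightarrow> complex \<Rightarrow> complex \<Rightarrow> complex" where
  "lap F u z = (LINT \<xi>:{0<..}|lborel. exp (- (z * of_real \<xi> * u)) * F (of_real \<xi> * u) * u)"

lemma norm_lap_integrand: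
  assumes "norm u = 1" "norm (F (of_real \<xi> * u)) \<le> A * exp (c * \<xi>)"
  shows "norm (exp (- (z * of_real \<xi> * u)) * F (of_real \<xi> * u) * u) \<le> A * exp (- (Re (z * u) - c) * \<xi>)"
proof -
  have "norm (exp (- (z * of_real \<xi> * u)) * F (of_real \<xi> * u) * u) = exp (- Re (z * u) * \<xi>) * norm (F (of_real \<xi> * u))"
    using assms(1) by (simp add: norm_mult algebra_simps)
  also have "\<dots> \<le> exp (- Re (z * u) * \<xi>) * (A * exp (c * \<xi>))"
    by (intro mult_left_mono assms) auto
  also have "\<dots> = A * exp (- (Re (z * u) - c) * \<xi>)"
    by (simp add: exp_add[symmetric] algebra_simps)
  finally show ?thesis .
qed

lemma continuous_on_lap_integrand:
  fixes F :: "complex \<Rightarrow> complex"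
  assumes "continuous_on ((\<lambda>\<xi>::real. of_real \<xi> * u) ` {0<..}) F"
  shows "continuous_on {0<..} (\<lambda>\<xi>::real. exp (- (z * of_real \<xi> * u)) * F (of_real \<xi> * u) * u)"
  by (intro continuous_intros continuous_on_compose2[OF assms]) auto

lemma lap_integrable:
  assumes "continuous_on ((\<lambda>\<xi>::real. of_real \<xi> * u) ` {0<..}) F" and u: "norm u = 1"
    and b: "\<And>\<xi>. \<xi> > 0 \<Longrightarrow> norm (F (of_real \<xi> * u)) \<le> A * exp (c * \<xi>)"
    and z: "Re (z * u) > c"
  shows "set_integrable lborel {0<..} (\<lambda>\<xi>. exp (- (z * of_real \<xi> * u)) * F (of_real \<xi> * u) * u)"
proof (rule set_integrable_bound)
  show "set_integrable lborel {0<..} (\<lambda>\<xi>. A * exp (- (Re (z * u) - c) * \<xi>))"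
    using z exp_decay_integrable(1)[of "Re (z * u) - c"] by (intro set_integrable_mult_right) auto
  show "set_borel_measurable lborel {0<..} (\<lambda>\<xi>. exp (- (z * of_real \<xi> * u)) * F (of_real \<xi> * u) * u)"
    unfolding set_borel_measurable_def
    using borel_measurable_continuous_on_indicator[OF _ continuous_on_lap_integrand[OF assms(1)]] by simp
  show "AE \<xi> in lborel. \<xi> \<in> {0<..} \<longrightarrow>
      norm (exp (- (z * of_real \<xi> * u)) * F (of_real \<xi> * u) * u) \<le> norm (A * exp (- (Re (z * u) - c) * \<xi>))"
  proof (intro always_eventually allI impI)
    fix \<xi> :: real assume "\<xi> \<in> {0<..}"
    then have "norm (F (of_real \<xi> * u)) \<le> A * exp (c * \<xi>)"
      using b by simp
    from norm_lap_integrand[of u F \<xi> A c z, OF u this]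
    show "norm (exp (- (z * of_real \<xi> * u)) * F (of_real \<xi> * u) * u) \<le> norm (A * exp (- (Re (z * u) - c) * \<xi>))"
      unfolding real_norm_def by (rule order_trans[OF _ abs_ge_self])
  qed
qed

lemma lap_bound:
  assumes "continuous_on ((\<lambda>\<xi>::real. of_real \<xi> * u) ` {0<..}) F" and u: "norm u = 1"
    and b: "\<And>\<xi>. \<xi> > 0 \<Longrightarrow> norm (F (of_real \<xi> * u)) \<le> A * exp (c * \<xi>)"
    and z: "Re (z * u) > c"
  shows "norm (lap F u z) \<le> A / (Re (z * u) - c)"
proof -
  have i: "set_integrable lborel {0<..} (\<lambda>\<xi>. A * exp (- (Re (z * u) - c) * \<xi>))"
    using z exp_decay_integrable(1)[of "Re (z * u) - c"] by (intro set_integrable_mult_right) auto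
  have "norm (lap F u z) \<le> (LINT \<xi>:{0<..}|lborel. A * exp (- (Re (z * u) - c) * \<xi>))"
    unfolding lap_def set_lebesgue_integral_def
    by (rule Bochner_Integration.integral_norm_bound_integral)
       (use lap_integrable[OF assms] i norm_lap_integrand[OF u, of _ _ A c z] b in \<open>auto simp: set_integrable_def indicator_def\<close>)
  also have "\<dots> = A * (1 / (Re (z * u) - c))"
    using z exp_decay_integrable(2)[of "Re (z * u) - c"] by (subst set_integral_mult_right) auto
  finally show ?thesis by simp
qed

lemma lap_cong: "(\<And>\<xi>. \<xi> > 0 \<Longrightarrow> F (of_real \<xi> * u) = G (of_real \<xi> * u)) \<Longrightarrow> lap F u z = lap G u z"
  unfolding lap_def by (intro set_lebesgue_integral_cong) auto

lemma lap_shift: "lap (\<lambda>\<zeta>. exp (- (a * \<zeta>)) * F \<zeta>) u z = lap F u (z + a)"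
  unfolding lap_def
proof (intro set_lebesgue_integral_cong allI impI)
  fix \<xi> :: real
  have "exp (- (z * of_real \<xi> * u)) * exp (- (a * (of_real \<xi> * u))) = exp (- ((z + a) * of_real \<xi> * u))"
    by (simp add: exp_add[symmetric] algebra_simps)
  then show "exp (- (z * of_real \<xi> * u)) * (exp (- (a * (of_real \<xi> * u))) * F (of_real \<xi> * u)) * u
      = exp (- ((z + a) * of_real \<xi> * u)) * F (of_real \<xi> * u) * u"
    by (simp add: mult.assoc[symmetric])
qed auto

lemma lap_add:
  assumes "set_integrable lborel {0<..} (\<lambda>\<xi>. exp (- (z * of_real \<xi> * u)) * F (of_real \<xi> * u) * u)"
    and "set_integrable lborel {0<..} (\<lambda>\<xi>. exp (- (z * of_real \<xi> * u)) * G (of_real \<xi> * u) * u)"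
  shows "lap (\<lambda>\<zeta>. F \<zeta> + G \<zeta>) u z = lap F u z + lap G u z"
  unfolding lap_def using set_integral_add(2)[OF assms] by (simp add: algebra_simps)

lemma lap_sum:
  assumes "\<And>p. p \<in> P \<Longrightarrow> set_integrable lborel {0<..} (\<lambda>\<xi>. exp (- (z * of_real \<xi> * u)) * F p (of_real \<xi> * u) * u)"
  shows "lap (\<lambda>\<zeta>. \<Sum>p\<in>P. F p \<zeta>) u z = (\<Sum>p\<in>P. lap (F p) u z)"
  using assms unfolding lap_def set_lebesgue_integral_def set_integrable_def
  by (simp add: sum_distrib_left sum_distrib_right scaleR_sum_right integral_sum)

lemma lap_cmult: "lap (\<lambda>\<zeta>. a * F \<zeta>) u z = a * lap F u z"
  unfolding lap_def by (subst set_integral_mult_right[symmetric]) (simp add: mult_ac)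

lemma lap_limit:
  assumes "\<And>N. continuous_on ((\<lambda>\<xi>::real. of_real \<xi> * u) ` {0<..}) (H N)" and u: "norm u = 1"
    and b: "\<And>N \<xi>. \<xi> > 0 \<Longrightarrow> norm (H N (of_real \<xi> * u)) \<le> A * exp (c * \<xi>)"
    and lim: "\<And>\<xi>. \<xi> > 0 \<Longrightarrow> (\<lambda>N. H N (of_real \<xi> * u)) \<longlonglongrightarrow> H' (of_real \<xi> * u)"
    and z: "Re (z * u) > c"
  shows "(\<lambda>N. lap (H N) u z) \<longlonglongrightarrow> lap H' u z"
  unfolding lap_def set_lebesgue_integral_def
proof (rule integral_dominated_convergence)
  let ?h = "\<lambda>H \<xi>. indicator {0<..} \<xi> *\<^sub>R (exp (- (z * of_real \<xi> * u)) * H (of_real \<xi> * u) * u)"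
  show m: "?h (H N) \<in> borel_measurable lborel" for N
    using borel_measurable_continuous_on_indicator[OF _ continuous_on_lap_integrand[OF assms(1)]] by simp
  have l: "(\<lambda>N. ?h (H N) \<xi>) \<longlonglongrightarrow> ?h H' \<xi>" for \<xi>
    by (cases "\<xi> > 0") (auto intro!: tendsto_intros lim)
  then show "AE \<xi> in lborel. (\<lambda>N. ?h (H N) \<xi>) \<longlonglongrightarrow> ?h H' \<xi>"
    by simp
  show "?h H' \<in> borel_measurable lborel"
    using l m by (rule borel_measurable_LIMSEQ_metric[rotated])
  show "integrable lborel (\<lambda>\<xi>. indicator {0<..} \<xi> *\<^sub>R (A * exp (- (Re (z * u) - c) * \<xi>)))"
    using z exp_decay_integrable(1)[of "Re (z * u) - c"] unfolding set_integrable_def[symmetric]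
    by (intro set_integrable_mult_right) auto
  show "AE \<xi> in lborel. norm (?h (H N) \<xi>) \<le> indicator {0<..} \<xi> *\<^sub>R (A * exp (- (Re (z * u) - c) * \<xi>))" for N
    using norm_lap_integrand[OF u, of _ _ A c z] b by (intro always_eventually allI) (auto simp: indicator_def)
qed

lemma integral_convolution:
  fixes a b :: "real \<Rightarrow> complex"
  assumes a: "integrable lborel a" and b: "integrable lborel b"
  shows "(LINT x|lborel. LINT y|lborel. b y * a (x - y)) = (LINT x|lborel. a x) * (LINT y|lborel. b y)"
proof -
  have [measurable]: "a \<in> borel_measurable borel" "b \<in> borel_measurable borel"
    using a b by (auto dest: borel_measurable_integrable)
  have ia: "integrable lborel (\<lambda>x. a (x - y))" for y
    using lborel_integrable_real_affine[OF a, of 1 "- y"] by simp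
  have ea: "(LINT x|lborel. a (x - y)) = (LINT x|lborel. a x)" for y
    using lborel_integral_real_affine[of 1 a "- y"] by simp
  have en: "(LINT x|lborel. norm (a (x - y))) = (LINT x|lborel. norm (a x))" for y
    using lborel_integral_real_affine[of 1 "\<lambda>x. norm (a x)" "- y"] by simp
  have "integrable (lborel \<Otimes>\<^sub>M lborel) (\<lambda>(y, x). b y * a (x - y))"
  proof (rule lborel_pair.Fubini_integrable)
    show "integrable lborel (\<lambda>y. LINT x|lborel. norm (case (y, x) of (y, x) \<Rightarrow> b y * a (x - y)))"
      using b by (simp add: norm_mult en)
    show "AE y in lborel. integrable lborel (\<lambda>x. case (y, x) of (y, x) \<Rightarrow> b y * a (x - y))"
      using ia by simp
  qed measurable
  from lborel_pair.Fubini_integral[OF this]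
  show ?thesis
    by (simp add: ea mult.commute)
qed

context star_open
begin

text \<open>Extended by zero to negative arguments, the two integrands have an ordinary convolution
  on the real line, and its value at x is the integrand for \<open>conv F G\<close>: the
  exponentials multiply to exp(-z x u), and y = x t turns the integral over 0 < y < x into
  \<open>conv\<close>. Fubini's theorem then gives the product.\<close>

lemma lap_conv:
  assumes F: "F holomorphic_on S" and G: "G holomorphic_on S"
    and ray: "\<And>\<xi>. 0 \<le> \<xi> \<Longrightarrow> of_real \<xi> * u \<in> S"
    and iF: "set_integrable lborel {0<..} (\<lambda>\<xi>. exp (- (z * of_real \<xi> * u)) * F (of_real \<xi> * u) * u)"
    and iG: "set_integrable lborel {0<..} (\<lambda>\<xi>. exp (- (z * of_real \<xi> * u)) * G (of_real \<xi> * u) * u)"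
  shows "lap (conv F G) u z = lap F u z * lap G u z"
proof -
  define a where "a = (\<lambda>\<xi>. indicator {0<..} \<xi> *\<^sub>R (exp (- (z * of_real \<xi> * u)) * F (of_real \<xi> * u) * u))"
  define b where "b = (\<lambda>\<xi>. indicator {0<..} \<xi> *\<^sub>R (exp (- (z * of_real \<xi> * u)) * G (of_real \<xi> * u) * u))"
  have "(LINT y|lborel. b y * a (x - y)) =
      indicator {0<..} x *\<^sub>R (exp (- (z * of_real x * u)) * conv F G (of_real x * u) * u)" for x
  proof (cases "x > 0")
    case False
    then have "(LINT y|lborel. b y * a (x - y)) = (LINT y|(lborel :: real measure). (0::complex))"
      by (intro Bochner_Integration.integral_cong) (auto simp: a_def b_def indicator_def)
    with False show ?thesis by simp
  next
    case True
    let ?h = "\<lambda>t. of_real x * u * F (of_real (1 - t) * (of_real x * u)) * G (of_real t * (of_real x * u))"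
    have h: "continuous_on {0..1} ?h"
      by (intro continuous_intros continuous_on_ray_1 holomorphic_on_imp_continuous_on F G ray) (use True in auto)
    then have "set_integrable lborel {0..1} ?h"
      by (rule borel_integrable_atLeastAtMost')
    then have h': "set_integrable lborel {0<..<1} ?h"
      by (rule set_integrable_subset) auto
    have "(LINT y|lborel. b y * a (x - y)) = x *\<^sub>R (LINT t|lborel. b (x * t) * a (x - x * t))"
      using True lborel_integral_real_affine[of x "\<lambda>y. b y * a (x - y)" 0] by simp
    \<comment> \<open>\<open>?h\<close> contains the factor x of \<open>conv\<close>. It is divided
      out here and compensated by the Jacobian of y = x t.\<close>
    also have "(LINT t|lborel. b (x * t) * a (x - x * t)) =
       (LINT t|lborel. (exp (- (z * of_real x * u)) * u / of_real x) * (indicator {0<..<1} t *\<^sub>R ?h t))"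
    proof (rule Bochner_Integration.integral_cong[OF refl])
      fix t
      have "exp (- (z * of_real (x * t) * u)) * exp (- (z * of_real (x - x * t) * u)) = exp (- (z * of_real x * u))"
        by (simp add: exp_add[symmetric] algebra_simps)
      moreover have "x * t < x \<longleftrightarrow> t < 1" "0 < x * t \<longleftrightarrow> 0 < t"
        using True by (auto simp: zero_less_mult_iff)
      ultimately show "b (x * t) * a (x - x * t) =
          (exp (- (z * of_real x * u)) * u / of_real x) * (indicator {0<..<1} t *\<^sub>R ?h t)"
        using True by (auto simp: a_def b_def indicator_def field_simps)
    qed
    also have "\<dots> = (exp (- (z * of_real x * u)) * u / of_real x) * (LINT t:{0<..<1}|lborel. ?h t)"
      unfolding set_lebesgue_integral_def by (rule integral_mult_right_zero)
    also have "(LINT t:{0<..<1}|lborel. ?h t) = conv F G (of_real x * u)"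
      using set_borel_integral_eq_integral(2)[OF h'] by (simp add: conv_def integral_open_interval_real)
    finally show ?thesis
      using True by (simp add: scaleR_conv_of_real)
  qed
  then have "lap (conv F G) u z = (LINT x|lborel. LINT y|lborel. b y * a (x - y))"
    by (simp only: lap_def set_lebesgue_integral_def)
  also have "\<dots> = (LINT x|lborel. a x) * (LINT y|lborel. b y)"
    using iF iG by (intro integral_convolution) (auto simp: a_def b_def set_integrable_def)
  finally show ?thesis
    by (simp only: lap_def set_lebesgue_integral_def a_def b_def)
qed

end

lemma power_le_exp: "0 \<le> (x::real) \<Longrightarrow> x ^ m / fact m \<le> exp x"
  using sum_le_suminf[OF summable_exp[of x], of "{m}"]
  by (simp add: exp_def divide_inverse mult.commute)

lemma sum_power_le_exp: "0 \<le> (x::real) \<Longrightarrow> (\<Sum>m<N. x ^ m / fact m) \<le> exp x"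
  using sum_le_suminf[OF summable_exp[of x], of "{..<N}"]
  by (simp add: exp_def divide_inverse mult.commute)

locale star_ray = star_open +
  fixes u :: complex
  assumes norm_u: "norm u = 1"
    and ray: "\<And>\<xi>. 0 \<le> \<xi> \<Longrightarrow> of_real \<xi> * u \<in> S"
begin

lemma continuous_on_ray_image:
  assumes "F holomorphic_on S"
  shows "continuous_on ((\<lambda>\<xi>::real. of_real \<xi> * u) ` {0<..}) F"
  using assms ray by (auto intro!: continuous_on_subset[OF holomorphic_on_imp_continuous_on])

lemmas lap_integrable' = lap_integrable[OF continuous_on_ray_image norm_u]

lemma lap_conv_funpow:
  assumes F: "F holomorphic_on S" and G: "G holomorphic_on S"
    and Fb: "\<And>s. 0 \<le> s \<Longrightarrow> norm (F (of_real s * u)) \<le> A * exp (c * s)"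
    and Gb: "\<And>s. 0 \<le> s \<Longrightarrow> norm (G (of_real s * u)) \<le> B * s ^ n / fact n * exp (c * s)"
    and A: "0 \<le> A" and B: "0 \<le> B" and z: "Re (z * u) > c"
  shows "lap ((conv F ^^ k) G) u z = lap F u z ^ k * lap G u z"
    and "set_integrable lborel {0<..} (\<lambda>\<xi>. exp (- (z * of_real \<xi> * u)) * (conv F ^^ k) G (of_real \<xi> * u) * u)"
proof -
  \<comment> \<open>The strict inequality for z leaves room to absorb the power s^(n+k) into exp(d
    s), so that integrability follows from a plain exponential bound.\<close>
  obtain d where d: "d > 0" "c + d < Re (z * u)"
    using z by (metis add.commute dense less_diff_eq diff_gt_0_iff_gt)
  have int: "set_integrable lborel {0<..} (\<lambda>\<xi>. exp (- (z * of_real \<xi> * u)) * (conv F ^^ k) G (of_real \<xi> * u) * u)" for k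
  proof (rule lap_integrable'[where A = "A ^ k * B / d ^ (n + k)" and c = "c + d"])
    show "(conv F ^^ k) G holomorphic_on S"
      by (rule conv_funpow_holomorphic[OF F G])
    fix s :: real assume s: "s > 0"
    have "norm ((conv F ^^ k) G (of_real s * u)) \<le> A ^ k * B * s ^ (n + k) / fact (n + k) * exp (c * s)"
      using norm_u s Fb Gb by (intro conv_funpow_bound[OF F G _ ray[of s]]) auto
    also have "\<dots> = A ^ k * B / d ^ (n + k) * ((d * s) ^ (n + k) / fact (n + k)) * exp (c * s)"
      using d by (simp add: power_mult_distrib)
    also have "\<dots> \<le> A ^ k * B / d ^ (n + k) * exp (d * s) * exp (c * s)"
      using A B d s by (intro mult_right_mono mult_left_mono power_le_exp) auto
    also have "\<dots> = A ^ k * B / d ^ (n + k) * exp ((c + d) * s)"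
      by (simp add: algebra_simps exp_add)
    finally show "norm ((conv F ^^ k) G (of_real s * u)) \<le> A ^ k * B / d ^ (n + k) * exp ((c + d) * s)" .
  qed (use d in auto)
  then show "set_integrable lborel {0<..} (\<lambda>\<xi>. exp (- (z * of_real \<xi> * u)) * (conv F ^^ k) G (of_real \<xi> * u) * u)" .
  have iF: "set_integrable lborel {0<..} (\<lambda>\<xi>. exp (- (z * of_real \<xi> * u)) * F (of_real \<xi> * u) * u)"
    using Fb by (intro lap_integrable'[where A = A and c = c] F z) auto
  show "lap ((conv F ^^ k) G) u z = lap F u z ^ k * lap G u z"
  proof (induction k)
    case (Suc k)
    have "lap (conv F ((conv F ^^ k) G)) u z = lap F u z * lap ((conv F ^^ k) G) u z"
      by (intro lap_conv F conv_funpow_holomorphic G ray iF int)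
    with Suc show ?case by simp
  qed simp
qed

text \<open>One bound serves twice: for the partial sums it is the majorant in dominated
  convergence, for the limit it is the growth estimate in \<open>N_bd\<close>.\<close>

lemma sum_comp_term_bound:
  assumes F: "F holomorphic_on S" and K: "K holomorphic_on S"
    and Fb: "\<And>s. 0 \<le> s \<Longrightarrow> norm (F (of_real s * u)) \<le> A * exp (c * s)"
    and Kb: "\<And>s. 0 \<le> s \<Longrightarrow> norm (K (of_real s * u)) \<le> B * exp (c * s)"
    and A: "0 \<le> A" and B: "0 \<le> B" and s: "s \<ge> 0"
  shows "norm (\<Sum>p<N. comp_term F K p (of_real s * u)) \<le> B * exp ((c + sqrt A) * s)"
    and "(\<lambda>N. \<Sum>p<N. comp_term F K p (of_real s * u)) \<longlonglongrightarrow> comp_series F K (of_real s * u)"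
    and "norm (comp_series F K (of_real s * u)) \<le> B * exp ((c + sqrt A) * s)"
proof -
  have t: "norm (comp_term F K p (of_real s * u)) \<le> B * exp (c * s) * ((sqrt A * s) ^ (2 * p) / fact (2 * p))" for p
    using norm_u s Fb Kb by (intro comp_term_bound[OF F K _ ray[of s] A]) auto
  have b: "norm (\<Sum>p<N. comp_term F K p (of_real s * u)) \<le> B * exp ((c + sqrt A) * s)" for N
  proof -
    have "norm (\<Sum>p<N. comp_term F K p (of_real s * u)) \<le> (\<Sum>p<N. B * exp (c * s) * ((sqrt A * s) ^ (2 * p) / fact (2 * p)))"
      by (rule sum_norm_le) (use t in auto)
    also have "\<dots> = B * exp (c * s) * (\<Sum>p<N. (sqrt A * s) ^ (2 * p) / fact (2 * p))"
      by (rule sum_distrib_left[symmetric])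
    also have "\<dots> \<le> B * exp (c * s) * exp (sqrt A * s)"
      using A B s by (intro mult_left_mono sum_even_exp_le) auto
    also have "\<dots> = B * exp ((c + sqrt A) * s)"
      by (simp add: algebra_simps exp_add)
    finally show ?thesis .
  qed
  then show "norm (\<Sum>p<N. comp_term F K p (of_real s * u)) \<le> B * exp ((c + sqrt A) * s)" .
  have "summable (\<lambda>p. B * exp (c * s) * ((sqrt A * s) ^ (2 * p) / fact (2 * p)))"
    using A s by (intro summable_mult summable_even_exp) auto
  then have "summable (\<lambda>p. comp_term F K p (of_real s * u))"
    using t by (rule summable_comparison_test'[where N = 0])
  then show l: "(\<lambda>N. \<Sum>p<N. comp_term F K p (of_real s * u)) \<longlonglongrightarrow> comp_series F K (of_real s * u)"
    unfolding comp_series_def by (rule summable_LIMSEQ)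
  show "norm (comp_series F K (of_real s * u)) \<le> B * exp ((c + sqrt A) * s)"
    using tendsto_norm[OF l] by (rule LIMSEQ_le_const2) (use b in auto)
qed

text \<open>Two series of functions have equal Laplace transforms term by term: the convolution
  terms, and \<Phi>^p times the unconvolved weights \<open>Kp p\<close>. The partial sums of both
  are dominated by B exp((c + sqrt A) s). The second series sums under the integral to exp(-\<Phi>
  \<zeta>) K(\<zeta>), whose transform at z is that of \<open>K\<close> at z + \<Phi>.\<close>

lemma lap_comp_series:
  assumes F: "F holomorphic_on S" and K: "K holomorphic_on S"
    and Fb: "\<And>s. 0 \<le> s \<Longrightarrow> norm (F (of_real s * u)) \<le> A * exp (c * s)"
    and Kb: "\<And>s. 0 \<le> s \<Longrightarrow> norm (K (of_real s * u)) \<le> B * exp (c * s)"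
    and A: "0 \<le> A" and B: "0 \<le> B" and z: "Re (z * u) > c + sqrt A"
  shows "norm (lap F u z) \<le> sqrt A"
    and "lap (comp_series F K) u z = lap K u (z + lap F u z)"
proof -
  have c: "Re (z * u) > c"
    using z A real_sqrt_ge_zero[OF A] by linarith
  have "norm (lap F u z) \<le> A / (Re (z * u) - c)"
    using Fb by (intro lap_bound[OF continuous_on_ray_image[OF F] norm_u _ c]) auto
  also have "\<dots> \<le> sqrt A"
  proof -
    \<comment> \<open>The margin Re(z u) - c exceeds sqrt A. Multiplying by it, rather than dividing
      by sqrt A, covers A = 0 as well.\<close>
    have "A = sqrt A * sqrt A"
      using A by simp
    also have "\<dots> \<le> sqrt A * (Re (z * u) - c)"
      using A z by (intro mult_left_mono) auto
    finally show ?thesis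
      using c by (simp add: divide_le_eq)
  qed
  finally show \<Phi>: "norm (lap F u z) \<le> sqrt A" .
  define \<Phi> where "\<Phi> = lap F u z"
  define Kp where "Kp = (\<lambda>p::nat. \<lambda>\<zeta>. (- \<zeta>) ^ p / fact p * K \<zeta>)"
  have Kp: "Kp p holomorphic_on S" for p
    unfolding Kp_def by (intro holomorphic_intros K) auto
  have Kpb: "norm (Kp p (of_real s * u)) \<le> B * s ^ p / fact p * exp (c * s)" if "s \<ge> 0" for p s
  proof -
    have "norm (Kp p (of_real s * u)) = s ^ p / fact p * norm (K (of_real s * u))"
      using that norm_u by (simp add: Kp_def norm_mult norm_divide norm_power)
    also have "\<dots> \<le> s ^ p / fact p * (B * exp (c * s))"
      using that by (intro mult_left_mono Kb) auto
    finally show ?thesis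
      by (simp add: mult_ac)
  qed
  note funpow = lap_conv_funpow[OF F Kp Fb Kpb A B c]
  have term_eq: "lap (comp_term F K p) u z = lap (\<lambda>\<zeta>. \<Phi> ^ p * Kp p \<zeta>) u z" for p
    using funpow(1)[of p p] unfolding comp_term_def \<Phi>_def lap_cmult Kp_def .
  have "(\<lambda>N. lap (\<lambda>\<zeta>. \<Sum>p<N. comp_term F K p \<zeta>) u z) \<longlonglongrightarrow> lap (comp_series F K) u z"
    using sum_comp_term_bound[OF F K Fb Kb A B]
    by (intro lap_limit[where A = B and c = "c + sqrt A"] continuous_on_ray_image norm_u z holomorphic_on_sum comp_term_holomorphic F K) auto
  moreover have "lap (\<lambda>\<zeta>. \<Sum>p<N. comp_term F K p \<zeta>) u z = lap (\<lambda>\<zeta>. \<Sum>p<N. \<Phi> ^ p * Kp p \<zeta>) u z" for N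
  proof -
    have "set_integrable lborel {0<..} (\<lambda>\<xi>. exp (- (z * of_real \<xi> * u)) * (\<Phi> ^ p * Kp p (of_real \<xi> * u)) * u)" for p
      using set_integrable_mult_right[OF funpow(2)[of 0 p], of "\<Phi> ^ p"] by (simp add: mult_ac)
    moreover have "set_integrable lborel {0<..} (\<lambda>\<xi>. exp (- (z * of_real \<xi> * u)) * comp_term F K p (of_real \<xi> * u) * u)" for p
      using funpow(2)[of p p] by (simp add: comp_term_def Kp_def)
    ultimately show ?thesis
      by (simp add: lap_sum term_eq)
  qed
  moreover have "(\<lambda>N. lap (\<lambda>\<zeta>. \<Sum>p<N. \<Phi> ^ p * Kp p \<zeta>) u z) \<longlonglongrightarrow> lap (\<lambda>\<zeta>. exp (- (\<Phi> * \<zeta>)) * K \<zeta>) u z"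
  proof (rule lap_limit[OF continuous_on_ray_image norm_u _ _ z])
    show "(\<lambda>\<zeta>. \<Sum>p<N. \<Phi> ^ p * Kp p \<zeta>) holomorphic_on S" for N
      by (intro holomorphic_intros Kp)
    have eq: "(\<Sum>p<N. \<Phi> ^ p * Kp p \<zeta>) = (\<Sum>p<N. (- (\<Phi> * \<zeta>)) ^ p / fact p) * K \<zeta>" for \<zeta> N
      unfolding sum_distrib_right
      by (intro sum.cong) (auto simp: Kp_def power_mult_distrib power_minus[of \<zeta>] power_minus[of "\<Phi> * \<zeta>"])
    fix s :: real assume s: "s > 0"
    \<comment> \<open>By \<open>norm \<Phi> \<le> sqrt A\<close>, the partial sums of exp(-\<Phi>
      \<zeta>) grow no faster than the rate already granted to the convolution series.\<close>
    have "norm (\<Sum>p<N. (- (\<Phi> * (of_real s * u))) ^ p / fact p) \<le> exp (sqrt A * s)" for N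
    proof -
      have "norm (\<Sum>p<N. (- (\<Phi> * (of_real s * u))) ^ p / fact p) \<le> (\<Sum>p<N. (norm \<Phi> * s) ^ p / fact p)"
        by (rule sum_norm_le) (use s norm_u in \<open>simp add: norm_divide norm_power norm_mult\<close>)
      also have "\<dots> \<le> exp (norm \<Phi> * s)"
        using s by (intro sum_power_le_exp) auto
      also have "\<dots> \<le> exp (sqrt A * s)"
        using s \<Phi> by (simp add: \<Phi>_def)
      finally show ?thesis .
    qed
    then have "norm (\<Sum>p<N. \<Phi> ^ p * Kp p (of_real s * u)) \<le> exp (sqrt A * s) * (B * exp (c * s))" for N
      unfolding eq norm_mult using s by (intro mult_mono Kb) auto
    then show "norm (\<Sum>p<N. \<Phi> ^ p * Kp p (of_real s * u)) \<le> B * exp ((c + sqrt A) * s)" for N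
      by (simp add: algebra_simps exp_add)
    have "(\<lambda>N. \<Sum>p<N. (- (\<Phi> * (of_real s * u))) ^ p /\<^sub>R fact p) \<longlonglongrightarrow> exp (- (\<Phi> * (of_real s * u)))"
      using exp_converges unfolding sums_def by blast
    then have "(\<lambda>N. \<Sum>p<N. (- (\<Phi> * (of_real s * u))) ^ p / fact p) \<longlonglongrightarrow> exp (- (\<Phi> * (of_real s * u)))"
      by (simp add: scaleR_conv_of_real divide_inverse mult.commute)
    then show "(\<lambda>N. \<Sum>p<N. \<Phi> ^ p * Kp p (of_real s * u)) \<longlonglongrightarrow> exp (- (\<Phi> * (of_real s * u))) * K (of_real s * u)"
      unfolding eq by (intro tendsto_mult tendsto_const)
  qed
  ultimately have "lap (comp_series F K) u z = lap (\<lambda>\<zeta>. exp (- (\<Phi> * \<zeta>)) * K \<zeta>) u z"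
    using LIMSEQ_unique by simp blast
  then show "lap (comp_series F K) u z = lap K u (z + lap F u z)"
    by (simp add: lap_shift \<Phi>_def)
qed

end

section \<open>Independence of the direction\<close>

lemma half_plane_inner: "half_plane \<theta> c = {z. inner (cnj (cis \<theta>)) z > c}"
  by (auto simp: half_plane_def inner_complex_def mult.commute)

lemma open_half_plane: "open (half_plane \<theta> c)"
  unfolding half_plane_inner by (rule open_halfspace_gt)

lemma convex_half_plane: "convex (half_plane \<theta> c)"
  unfolding half_plane_inner by (rule convex_halfspace_gt)

text \<open>Cut off at N, the integral is entire in z and can be evaluated by a primitive of the
  integrand. The first fact gives holomorphy of \<open>lap\<close> in the limit, the second allows
  the ray to be rotated.\<close>

definition trunc_lap :: "(complex \<Rightarrow> complex) \<Rightarrow> complex \<Rightarrow> real \<Rightarrow> complex \<Rightarrow> complex" where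
  "trunc_lap F u N z = integral {0..N} (\<lambda>\<xi>. exp (- (z * of_real \<xi> * u)) * F (of_real \<xi> * u) * u)"

context star_ray
begin

lemma continuous_on_ray_real:
  assumes "F holomorphic_on S"
  shows "continuous_on {0..} (\<lambda>\<xi>::real. F (of_real \<xi> * u))"
  by (rule continuous_on_compose2[OF holomorphic_on_imp_continuous_on[OF assms]])
     (auto intro!: continuous_intros ray)

text \<open>Beyond N the decay exp(-d \<xi>) is shared: one half gives exp(-d N / 2), the other
  stays integrable. The bound is uniform on Re(z u) \<ge> c + d, as locally uniform convergence
  requires.\<close>

lemma trunc_lap_bound:
  assumes F: "F holomorphic_on S"
    and Fb: "\<And>s. 0 \<le> s \<Longrightarrow> norm (F (of_real s * u)) \<le> A * exp (c * s)"
    and d: "d > 0" and z: "Re (z * u) \<ge> c + d" and N: "0 \<le> N"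
  shows "norm (trunc_lap F u N z - lap F u z) \<le> A * (2 / d) * exp (- d / 2 * N)"
proof -
  let ?h = "\<lambda>\<xi>. exp (- (z * of_real \<xi> * u)) * F (of_real \<xi> * u) * u"
  have int: "set_integrable lborel {0<..} ?h"
    using Fb z d by (intro lap_integrable'[where A = A and c = c] F) auto
  then have int1: "set_integrable lborel {0<..N} ?h" and int2: "set_integrable lborel {N<..} ?h"
    using N by (auto intro: set_integrable_subset)
  have "{0<..N} \<union> {N<..} = {0<..}"
    using N by auto
  moreover have "(LINT \<xi>:{0<..N} \<union> {N<..}|lborel. ?h \<xi>) = (LINT \<xi>:{0<..N}|lborel. ?h \<xi>) + (LINT \<xi>:{N<..}|lborel. ?h \<xi>)"
    by (rule set_integral_Un[OF _ int1 int2]) auto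
  ultimately have "lap F u z = (LINT \<xi>:{0<..N}|lborel. ?h \<xi>) + (LINT \<xi>:{N<..}|lborel. ?h \<xi>)"
    unfolding lap_def by argo
  moreover have "(LINT \<xi>:{0<..N}|lborel. ?h \<xi>) = trunc_lap F u N z"
  proof -
    have "(LINT \<xi>:{0<..N}|lborel. ?h \<xi>) = integral {0<..N} ?h"
      using int1 by (rule set_borel_integral_eq_integral)
    also have "\<dots> = integral {0..N} ?h"
      by (rule integral_spike_set; rule negligible_subset[of "{0}"]) auto
    finally show ?thesis
      by (simp only: trunc_lap_def)
  qed
  ultimately have "norm (trunc_lap F u N z - lap F u z) = norm (LINT \<xi>:{N<..}|lborel. ?h \<xi>)"
    by (simp add: norm_minus_commute)
  also have "\<dots> \<le> (LINT \<xi>:{0<..}|lborel. A * exp (- d / 2 * N) * exp (- (d / 2) * \<xi>))"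
    unfolding set_lebesgue_integral_def
  proof (rule Bochner_Integration.integral_norm_bound_integral)
    show "integrable lborel (\<lambda>\<xi>. indicator {N<..} \<xi> *\<^sub>R ?h \<xi>)"
      using int2 by (simp add: set_integrable_def)
    have "set_integrable lborel {0<..} (\<lambda>\<xi>. A * exp (- d / 2 * N) * exp (- (d / 2) * \<xi>))"
      using d by (intro set_integrable_mult_right exp_decay_integrable(1)) auto
    then show "integrable lborel (\<lambda>\<xi>. indicator {0<..} \<xi> *\<^sub>R (A * exp (- d / 2 * N) * exp (- (d / 2) * \<xi>)))"
      by (simp add: set_integrable_def)
    fix \<xi> :: real
    have "0 \<le> A * exp (c * 0)"
      using Fb[of 0] order_trans[OF norm_ge_zero] by blast
    then have A: "0 \<le> A" by simp
    show "norm (indicator {N<..} \<xi> *\<^sub>R ?h \<xi>) \<le> indicator {0<..} \<xi> *\<^sub>R (A * exp (- d / 2 * N) * exp (- (d / 2) * \<xi>))"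
    proof (cases "\<xi> > N")
      case True
      have "norm (?h \<xi>) \<le> A * exp (- (Re (z * u) - c) * \<xi>)"
        using True N by (intro norm_lap_integrand norm_u Fb) auto
      also have "\<dots> \<le> A * exp (- d / 2 * N + - (d / 2) * \<xi>)"
      proof (rule mult_left_mono[OF _ A])
        have "d * \<xi> \<le> (Re (z * u) - c) * \<xi>"
          using True N z by (intro mult_right_mono) auto
        moreover have "d * N \<le> d * \<xi>"
          using True d by simp
        ultimately show "exp (- (Re (z * u) - c) * \<xi>) \<le> exp (- d / 2 * N + - (d / 2) * \<xi>)"
          by (simp add: field_simps)
      qed
      also have "\<dots> = A * exp (- d / 2 * N) * exp (- (d / 2) * \<xi>)"
        by (simp only: exp_add mult.assoc)
      finally show ?thesis
        using True N by simp
    qed (use A in auto)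
  qed
  also have "\<dots> = A * exp (- d / 2 * N) * (1 / (d / 2))"
    using d exp_decay_integrable(2)[of "d / 2"] by (subst set_integral_mult_right) auto
  finally show ?thesis
    by (simp add: mult_ac)
qed

lemma trunc_lap_tendsto:
  assumes F: "F holomorphic_on S"
    and Fb: "\<And>s. 0 \<le> s \<Longrightarrow> norm (F (of_real s * u)) \<le> A * exp (c * s)"
    and z: "Re (z * u) > c"
  shows "(\<lambda>N::nat. trunc_lap F u (real N) z) \<longlonglongrightarrow> lap F u z"
proof -
  define d where "d = Re (z * u) - c"
  have d: "d > 0" "Re (z * u) \<ge> c + d"
    using z by (auto simp: d_def)
  have "(\<lambda>N::nat. trunc_lap F u (real N) z - lap F u z) \<longlonglongrightarrow> 0"
  proof (rule Lim_null_comparison)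
    show "\<forall>\<^sub>F N in sequentially. norm (trunc_lap F u (real N) z - lap F u z) \<le> A * (2 / d) * exp (- d / 2 * real N)"
      using trunc_lap_bound[OF F Fb d] by (intro always_eventually allI) simp
    show "(\<lambda>N. A * (2 / d) * exp (- d / 2 * real N)) \<longlonglongrightarrow> 0"
      using d(1) by real_asymp
  qed
  then show ?thesis
    by (rule LIM_zero_cancel)
qed

lemma trunc_lap_holomorphic:
  assumes F: "F holomorphic_on S"
  shows "trunc_lap F u N holomorphic_on UNIV"
proof -
  have cont: "continuous_on (UNIV \<times> {0..N}) (\<lambda>x. F (of_real (snd x) * u))"
    by (rule continuous_on_compose2[OF continuous_on_ray_real[OF F]]) (auto intro!: continuous_intros)
  have "(\<lambda>z. integral (cbox 0 N) (\<lambda>\<xi>. exp (- (z * of_real \<xi> * u)) * F (of_real \<xi> * u) * u)) holomorphic_on UNIV"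
  proof (rule leibniz_rule_holomorphic)
    show "((\<lambda>z. exp (- (z * of_real \<xi> * u)) * F (of_real \<xi> * u) * u) has_field_derivative
        - (of_real \<xi> * u) * exp (- (z * of_real \<xi> * u)) * F (of_real \<xi> * u) * u) (at z)" for z and \<xi> :: real
      by (auto intro!: derivative_eq_intros)
    show "(\<lambda>\<xi>. exp (- (z * of_real \<xi> * u)) * F (of_real \<xi> * u) * u) integrable_on cbox 0 N" for z
      unfolding box_real
      by (intro integrable_continuous_real continuous_intros continuous_on_subset[OF continuous_on_ray_real[OF F]]) auto
    show "continuous_on (UNIV \<times> cbox 0 N)
        (\<lambda>(z, \<xi>). - (of_real \<xi> * u) * exp (- (z * of_real \<xi> * u)) * F (of_real \<xi> * u) * u)"
      unfolding split_beta box_real by (intro continuous_intros cont)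
  qed auto
  then show ?thesis
    by (simp add: trunc_lap_def[abs_def])
qed

lemma lap_holomorphic:
  assumes F: "F holomorphic_on S"
    and Fb: "\<And>s. 0 \<le> s \<Longrightarrow> norm (F (of_real s * u)) \<le> A * exp (c * s)"
  shows "lap F u holomorphic_on {z. Re (z * u) > c}"
proof (rule holomorphic_uniform_sequence)
  show op: "open {z. Re (z * u) > c}"
    by (intro open_Collect_less continuous_intros)
  show "trunc_lap F u (real N) holomorphic_on {z. Re (z * u) > c}" for N :: nat
    by (rule holomorphic_on_subset[OF trunc_lap_holomorphic[OF F]]) auto
  fix z assume z: "z \<in> {z. Re (z * u) > c}"
  \<comment> \<open>Half the distance from z to the boundary line, so that the closed ball of radius
    d keeps at least the distance d from it.\<close>
  define d where "d = (Re (z * u) - c) / 2"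
  have d: "d > 0"
    using z by (simp add: d_def)
  have w: "Re (w * u) \<ge> c + d" if "w \<in> cball z d" for w
  proof -
    have "Re ((z - w) * u) \<le> norm ((z - w) * u)"
      by (rule complex_Re_le_cmod)
    also have "\<dots> \<le> d"
      using that norm_u by (simp add: norm_mult dist_norm)
    finally show ?thesis
      by (simp add: d_def algebra_simps) argo
  qed
  have "uniform_limit (cball z d) (\<lambda>N w. trunc_lap F u (real N) w) (lap F u) sequentially"
  proof (rule uniform_limitI)
    fix e :: real assume "e > 0"
    have "(\<lambda>N. A * (2 / d) * exp (- d / 2 * real N)) \<longlonglongrightarrow> 0"
      using d by real_asymp
    then have "\<forall>\<^sub>F N in sequentially. A * (2 / d) * exp (- d / 2 * real N) < e"
      using \<open>e > 0\<close> by (rule order_tendstoD)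
    then show "\<forall>\<^sub>F N in sequentially. \<forall>w\<in>cball z d. dist (trunc_lap F u (real N) w) (lap F u w) < e"
    proof eventually_elim
      case (elim N)
      show ?case
      proof
        fix w assume "w \<in> cball z d"
        from trunc_lap_bound[OF F Fb d w[OF this], of "real N"] elim
        show "dist (trunc_lap F u (real N) w) (lap F u w) < e"
          by (simp add: dist_norm)
      qed
    qed
  qed
  moreover have "cball z d \<subseteq> {z. Re (z * u) > c}"
    using w d by force
  ultimately show "\<exists>d>0. cball z d \<subseteq> {z. Re (z * u) > c} \<and>
      uniform_limit (cball z d) (\<lambda>N. trunc_lap F u (real N)) (lap F u) sequentially"
    using d by blast
qed

end

context star_open
begin

lemma trunc_lap_eq_primitive:
  assumes "\<And>\<zeta>. \<zeta> \<in> S \<Longrightarrow> (P has_field_derivative exp (- (z * \<zeta>)) * F \<zeta>) (at \<zeta>)"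
    and ray: "\<And>\<xi>. 0 \<le> \<xi> \<Longrightarrow> of_real \<xi> * u \<in> S" and N: "0 \<le> N"
  shows "trunc_lap F u N z = P (of_real N * u) - P 0"
proof -
  have "((\<lambda>\<xi>. exp (- (z * of_real \<xi> * u)) * F (of_real \<xi> * u) * u) has_integral
      P (of_real N * u) - P (of_real 0 * u)) {0..N}"
  proof (rule fundamental_theorem_of_calculus[OF N])
    fix \<xi> :: real assume "\<xi> \<in> {0..N}"
    then have "of_real \<xi> * u \<in> S"
      using ray by simp
    then show "((\<lambda>\<xi>. P (of_real \<xi> * u)) has_vector_derivative
        exp (- (z * of_real \<xi> * u)) * F (of_real \<xi> * u) * u) (at \<xi> within {0..N})"
      by (intro has_vector_derivative_eq_rhs[OF field_vector_diff_chain_within[unfolded o_def,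
            where g = P and f = "\<lambda>\<xi>. of_real \<xi> * u" and f' = u]])
         (auto intro!: derivative_eq_intros DERIV_subset[OF assms(1)]
            simp: has_vector_derivative_def scaleR_conv_of_real mult_ac)
  qed
  from integral_unique[OF this] show ?thesis
    unfolding trunc_lap_def by (simp only: of_real_0 mult_zero_left)
qed

text \<open>
  The growth exponents \<open>c1\<close>, \<open>c2\<close> on the two extreme rays may be smaller than those in between, so that
  \<open>z\<close> need not be admissible for the intermediate directions. The contour is therefore rotated only for
  \<open>z\<close> far out on the bisector of the two half-planes; the identity theorem does the rest.
\<close>
lemma lap_rotate:
  assumes F: "F holomorphic_on S" and \<theta>: "\<theta>1 < \<theta>2" "\<theta>2 - \<theta>1 < pi"
    and ray: "\<And>\<theta> s. \<theta>1 \<le> \<theta> \<Longrightarrow> \<theta> \<le> \<theta>2 \<Longrightarrow> 0 \<le> s \<Longrightarrow> of_real s * cis \<theta> \<in> S"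
    and Fb: "\<And>\<theta> s. \<theta>1 \<le> \<theta> \<Longrightarrow> \<theta> \<le> \<theta>2 \<Longrightarrow> 0 \<le> s \<Longrightarrow> norm (F (of_real s * cis \<theta>)) \<le> A * exp (c * s)"
    and Fb1: "\<And>s. 0 \<le> s \<Longrightarrow> norm (F (of_real s * cis \<theta>1)) \<le> A1 * exp (c1 * s)"
    and Fb2: "\<And>s. 0 \<le> s \<Longrightarrow> norm (F (of_real s * cis \<theta>2)) \<le> A2 * exp (c2 * s)"
    and c: "0 \<le> c" "c1 \<le> c" "c2 \<le> c"
    and z: "z \<in> half_plane \<theta>1 c1" "z \<in> half_plane \<theta>2 c2"
  shows "lap F (cis \<theta>1) z = lap F (cis \<theta>2) z"
proof -
  interpret r1: star_ray S "cis \<theta>1"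
    using \<theta> ray by unfold_locales auto
  interpret r2: star_ray S "cis \<theta>2"
    using \<theta> ray by unfold_locales auto
  define \<mu> where "\<mu> = (\<theta>1 + \<theta>2) / 2"
  \<comment> \<open>The smallest cosine of the angle between the bisector and a direction in
    [\<theta>1, \<theta>2]; it is positive because the opening is less than pi.\<close>
  define \<kappa> where "\<kappa> = cos ((\<theta>2 - \<theta>1) / 2)"
  have \<kappa>: "\<kappa> > 0"
    unfolding \<kappa>_def using \<theta> by (intro cos_gt_zero_pi) auto
  have Re_ge: "Re (of_real \<rho> * cis (- \<mu>) * cis \<theta>) \<ge> \<rho> * \<kappa>" if "\<rho> \<ge> 0" "\<theta>1 \<le> \<theta>" "\<theta> \<le> \<theta>2" for \<rho> \<theta>
  proof -
    have "\<kappa> \<le> cos \<bar>\<theta> - \<mu>\<bar>"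
      unfolding \<kappa>_def using that \<theta> by (intro cos_monotone_0_pi_le) (auto simp: \<mu>_def field_simps abs_le_iff)
    moreover have "Re (of_real \<rho> * cis (- \<mu>) * cis \<theta>) = \<rho> * cos \<bar>\<theta> - \<mu>\<bar>"
      by (simp add: mult.assoc cis_mult cos_abs_real)
    ultimately show ?thesis
      using that(1) by (simp add: mult_left_mono)
  qed
  have eq: "lap F (cis \<theta>1) (of_real \<rho> * cis (- \<mu>)) = lap F (cis \<theta>2) (of_real \<rho> * cis (- \<mu>))" if \<rho>: "\<rho> > c / \<kappa>" for \<rho>
  proof -
    define w where "w = of_real \<rho> * cis (- \<mu>)"
    have "\<rho> > 0"
      using \<rho> c \<kappa> by (meson divide_nonneg_pos le_less_trans)
    have \<rho>\<kappa>: "\<rho> * \<kappa> > c"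
      using \<rho> \<kappa> by (simp add: field_simps)
    have hol: "(\<lambda>\<zeta>. exp (- (w * \<zeta>)) * F \<zeta>) holomorphic_on S"
      by (intro holomorphic_intros F)
    \<comment> \<open>A primitive on all of \<open>S\<close> turns the difference of the two
      truncated integrals into its increment along the arc of radius N.\<close>
    have "starlike S"
      unfolding starlike_def
    proof (intro bexI[of _ 0] ballI subsetI)
      fix x y assume "x \<in> S" "y \<in> closed_segment 0 x"
      then show "y \<in> S"
        using star_S by (auto simp: in_segment scaleR_conv_of_real)
    qed (rule zero_S)
    then obtain P where P: "\<And>\<zeta>. \<zeta> \<in> S \<Longrightarrow> (P has_field_derivative exp (- (w * \<zeta>)) * F \<zeta>) (at \<zeta>)"
      using holomorphic_starlike_primitive[OF holomorphic_on_imp_continuous_on[OF hol] _ open_S finite.emptyI]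
        holomorphic_on_imp_differentiable_at[OF hol open_S] by auto
    \<comment> \<open>Mean value inequality in the angle: the integrand on the arc is at most A
      exp((c - \<rho> \<kappa>) N), and the arc has length N (\<theta>2 - \<theta>1). For \<rho> > c
      / \<kappa> the product tends to 0.\<close>
    have diff: "norm (P (of_real N * cis \<theta>2) - P (of_real N * cis \<theta>1))
        \<le> (A * N * exp ((c - \<rho> * \<kappa>) * N)) * norm (\<theta>2 - \<theta>1)" if N: "N \<ge> 0" for N
    proof (rule differentiable_bound[where S = "{\<theta>1..\<theta>2}" and f = "\<lambda>\<theta>. P (of_real N * cis \<theta>)"
          and f' = "\<lambda>\<theta> h. h *\<^sub>R (exp (- (w * (of_real N * cis \<theta>))) * F (of_real N * cis \<theta>) * (of_real N * (\<i> * cis \<theta>)))"])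
      fix \<theta> assume t: "\<theta> \<in> {\<theta>1..\<theta>2}"
      have "((\<lambda>\<theta>. of_real N * cis \<theta>) has_vector_derivative of_real N * (\<i> * cis \<theta>)) (at \<theta> within {\<theta>1..\<theta>2})"
        unfolding has_vector_derivative_def
        by (auto intro!: derivative_eq_intros simp: scaleR_conv_of_real mult_ac)
      then show "((\<lambda>\<theta>. P (of_real N * cis \<theta>)) has_derivative (\<lambda>h. h *\<^sub>R (exp (- (w * (of_real N * cis \<theta>))) * F (of_real N * cis \<theta>) * (of_real N * (\<i> * cis \<theta>)))))
          (at \<theta> within {\<theta>1..\<theta>2})"
        unfolding has_vector_derivative_def[symmetric]
        using t N ray
        by (intro has_vector_derivative_eq_rhs[OF field_vector_diff_chain_within[unfolded o_def, where g = P
              and f = "\<lambda>\<theta>. of_real N * cis \<theta>" and f' = "of_real N * (\<i> * cis \<theta>)"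
              and g' = "exp (- (w * (of_real N * cis \<theta>))) * F (of_real N * cis \<theta>)"]])
           (auto intro!: DERIV_subset[OF P])
      have "norm (exp (- (w * (of_real N * cis \<theta>))) * F (of_real N * cis \<theta>) * (of_real N * (\<i> * cis \<theta>)))
         = exp (- (N * Re (w * cis \<theta>))) * norm (F (of_real N * cis \<theta>)) * N"
        using N by (simp add: norm_mult algebra_simps)
      also have "\<dots> \<le> exp (- (N * (\<rho> * \<kappa>))) * (A * exp (c * N)) * N"
        using N t Re_ge[of \<rho> \<theta>] \<open>\<rho> > 0\<close> Fb
        by (intro mult_right_mono mult_mono) (auto simp: w_def mult_left_mono)
      also have "\<dots> = A * N * exp ((c - \<rho> * \<kappa>) * N)"
        by (simp add: left_diff_distrib exp_diff exp_minus field_simps)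
      finally show "onorm (\<lambda>h. h *\<^sub>R (exp (- (w * (of_real N * cis \<theta>))) * F (of_real N * cis \<theta>) * (of_real N * (\<i> * cis \<theta>))))
          \<le> A * N * exp ((c - \<rho> * \<kappa>) * N)"
        by (intro onorm_le) (simp add: mult.commute mult_left_mono)
    qed (use \<theta> in auto)
    have T: "trunc_lap F (cis \<theta>2) N w - trunc_lap F (cis \<theta>1) N w = P (of_real N * cis \<theta>2) - P (of_real N * cis \<theta>1)"
      if "N \<ge> 0" for N
      using trunc_lap_eq_primitive[OF P r1.ray that] trunc_lap_eq_primitive[OF P r2.ray that] by simp
    have "(\<lambda>N::nat. trunc_lap F (cis \<theta>2) (real N) w - trunc_lap F (cis \<theta>1) (real N) w) \<longlonglongrightarrow> 0"
    proof (rule Lim_null_comparison)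
      show "\<forall>\<^sub>F N in sequentially. norm (trunc_lap F (cis \<theta>2) (real N) w - trunc_lap F (cis \<theta>1) (real N) w)
          \<le> (A * real N * exp ((c - \<rho> * \<kappa>) * real N)) * norm (\<theta>2 - \<theta>1)"
        using diff T by (intro always_eventually allI) (simp del: of_real_of_nat_eq)
      show "(\<lambda>N. (A * real N * exp ((c - \<rho> * \<kappa>) * real N)) * norm (\<theta>2 - \<theta>1)) \<longlonglongrightarrow> 0"
        using \<rho>\<kappa> by real_asymp
    qed
    moreover have "(\<lambda>N::nat. trunc_lap F (cis \<theta>2) (real N) w - trunc_lap F (cis \<theta>1) (real N) w)
        \<longlonglongrightarrow> lap F (cis \<theta>2) w - lap F (cis \<theta>1) w"
      using Re_ge[of \<rho> \<theta>1] Re_ge[of \<rho> \<theta>2] \<open>\<rho> > 0\<close> \<theta> \<rho>\<kappa>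
      by (intro tendsto_diff r1.trunc_lap_tendsto[OF F, of A c] r2.trunc_lap_tendsto[OF F, of A c] Fb)
         (auto simp: w_def)
    ultimately have "lap F (cis \<theta>2) w - lap F (cis \<theta>1) w = 0"
      using LIMSEQ_unique by blast
    then show ?thesis
      by (simp add: w_def)
  qed
  define T where "T = half_plane \<theta>1 c1 \<inter> half_plane \<theta>2 c2"
  \<comment> \<open>The part of the bisector on which equality is known. It accumulates at a point
    of the convex set \<open>T\<close>, as the identity theorem requires.\<close>
  define U where "U = (\<lambda>\<rho>. of_real \<rho> * cis (- \<mu>)) ` {c / \<kappa><..}"
  have \<rho>0: "\<rho> \<ge> 0" if "\<rho> > c / \<kappa>" for \<rho>
    using that c \<kappa> by (meson divide_nonneg_pos le_less_trans less_imp_le)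
  have UT: "U \<subseteq> T"
  proof
    fix x assume "x \<in> U"
    then obtain \<rho> where x: "x = of_real \<rho> * cis (- \<mu>)" and \<rho>: "\<rho> > c / \<kappa>"
      by (auto simp: U_def)
    have "c < \<rho> * \<kappa>"
      using \<rho> \<kappa> by (simp add: field_simps)
    with Re_ge[OF \<rho>0[OF \<rho>], of \<theta>1] Re_ge[OF \<rho>0[OF \<rho>], of \<theta>2] \<theta> c show "x \<in> T"
      unfolding T_def half_plane_def x by simp
  qed
  define x0 where "x0 = of_real (c / \<kappa> + 1) * cis (- \<mu>)"
  have x0: "x0 \<in> U"
    unfolding x0_def U_def by (rule imageI) auto
  have "x0 islimpt U"
    unfolding islimpt_approachable
  proof (intro allI impI)
    fix e :: real assume "e > 0"
    show "\<exists>x'\<in>U. x' \<noteq> x0 \<and> dist x' x0 < e"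
    proof (intro bexI conjI)
      show "of_real (c / \<kappa> + 1 + e / 2) * cis (- \<mu>) \<in> U"
        unfolding U_def using \<open>e > 0\<close> by (intro imageI) auto
      have "of_real (c / \<kappa> + 1 + e / 2) * cis (- \<mu>) - x0 = of_real (e / 2) * cis (- \<mu>)"
        by (simp add: x0_def algebra_simps)
      then have "dist (of_real (c / \<kappa> + 1 + e / 2) * cis (- \<mu>)) x0 = e / 2"
        unfolding dist_norm using \<open>e > 0\<close> by (simp only: norm_mult) simp
      then show "of_real (c / \<kappa> + 1 + e / 2) * cis (- \<mu>) \<noteq> x0" "dist (of_real (c / \<kappa> + 1 + e / 2) * cis (- \<mu>)) x0 < e"
        using \<open>e > 0\<close> by auto
    qed
  qed
  moreover have "(\<lambda>z. lap F (cis \<theta>1) z - lap F (cis \<theta>2) z) holomorphic_on T"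
    unfolding T_def half_plane_def
    by (intro holomorphic_on_diff holomorphic_on_subset[OF r1.lap_holomorphic[OF F Fb1]]
        holomorphic_on_subset[OF r2.lap_holomorphic[OF F Fb2]]) auto
  moreover have "open T" "connected T"
    unfolding T_def by (auto intro!: open_Int open_half_plane convex_connected convex_Int convex_half_plane)
  moreover have "z \<in> T" "x0 \<in> T"
    using z UT x0 by (auto simp: T_def)
  moreover have "lap F (cis \<theta>1) x - lap F (cis \<theta>2) x = 0" if "x \<in> U" for x
    using that eq by (auto simp: U_def)
  ultimately have "lap F (cis \<theta>1) z - lap F (cis \<theta>2) z = 0"
    using UT by (intro analytic_continuation[of "\<lambda>z. lap F (cis \<theta>1) z - lap F (cis \<theta>2) z" T U x0 z])
  then show ?thesis by simp
qed

end

section \<open>Composition in a fixed direction\<close>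

lemma star_ray_sector:
  assumes "open I" "r > 0" "\<theta> \<in> I"
  shows "star_ray (ball 0 r \<union> sector I) (cis \<theta>)"
proof -
  interpret star_open "ball 0 r \<union> sector I"
    by (rule star_open_borel_domain[OF assms(1,2)])
  show ?thesis
  proof
    show "of_real \<xi> * cis \<theta> \<in> ball 0 r \<union> sector I" if "0 \<le> \<xi>" for \<xi>
      using that assms ray_in_sector[of \<theta> I \<xi>] by (cases "\<xi> = 0") auto
  qed auto
qed

text \<open>The bound given for some continuation passes to the chosen one by uniqueness, and to s =
  0 by continuity along the ray; the convolution estimates work on the closed ray.\<close>

lemma N_bdE:
  assumes "\<phi> \<in> N_bd I \<gamma> \<alpha>" "open I" "is_interval I"
  obtains r where "r > 0" "continuation I \<phi> holomorphic_on ball 0 r \<union> sector I"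
    "continues_to I \<phi> (continuation I \<phi>)"
    "\<And>\<theta> s. \<theta> \<in> I \<Longrightarrow> 0 \<le> s \<Longrightarrow> norm (continuation I \<phi> (of_real s * cis \<theta>)) \<le> \<alpha> \<theta> * exp (\<gamma> \<theta> * s)"
proof -
  let ?F = "continuation I \<phi>"
  from assms(1) obtain F' where F': "continues_to I \<phi> F'"
    and b: "\<And>\<theta> \<xi>. \<theta> \<in> I \<Longrightarrow> \<xi> > 0 \<Longrightarrow> norm (F' (of_real \<xi> * cis \<theta>)) \<le> \<alpha> \<theta> * exp (\<gamma> \<theta> * \<xi>)"
    by (auto simp: N_bd_def)
  have F: "continues_to I \<phi> ?F"
    using F' by (rule continues_to_continuation)
  obtain r where r: "r > 0" "?F holomorphic_on ball 0 r \<union> sector I"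
    using continues_to_domain[OF F assms(2)] .
  have "norm (?F (of_real s * cis \<theta>)) \<le> \<alpha> \<theta> * exp (\<gamma> \<theta> * s)" if \<theta>: "\<theta> \<in> I" and s: "0 \<le> s" for \<theta> s
  proof -
    interpret star_ray "ball 0 r \<union> sector I" "cis \<theta>"
      by (rule star_ray_sector[OF assms(2) r(1) \<theta>])
    have pos: "norm (?F (of_real s * cis \<theta>)) \<le> \<alpha> \<theta> * exp (\<gamma> \<theta> * s)" if "s > 0" for s
      using b[OF \<theta> that] continues_to_unique[OF F F' assms(2,3) ray_in_sector[OF \<theta> that]] by simp
    have "((\<lambda>s. ?F (of_real s * cis \<theta>)) \<longlongrightarrow> ?F (of_real 0 * cis \<theta>)) (at 0 within {0..})"
      using continuous_on_ray_real[OF r(2)] unfolding continuous_on_def by (rule bspec) simp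
    then have l: "((\<lambda>s. ?F (of_real s * cis \<theta>)) \<longlongrightarrow> ?F (of_real 0 * cis \<theta>)) (at_right 0)"
      by (rule tendsto_within_subset) auto
    have r: "((\<lambda>s. \<alpha> \<theta> * exp (\<gamma> \<theta> * s)) \<longlongrightarrow> \<alpha> \<theta> * exp (\<gamma> \<theta> * 0)) (at_right 0)"
      by (intro tendsto_intros)
    have "norm (?F (of_real 0 * cis \<theta>)) \<le> \<alpha> \<theta> * exp (\<gamma> \<theta> * 0)"
      by (rule tendsto_le[OF _ r tendsto_norm[OF l]]) (auto simp: eventually_at_right_less pos intro: eventually_mono[OF eventually_at_right_less])
    with pos s show ?thesis
      by (cases "s = 0") auto
  qed
  with r F show ?thesis
    by (intro that) auto
qed

lemma locally_bounded_on_upper: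
  assumes "locally_bounded_on I h" "{a..b} \<subseteq> I"
  obtains B where "0 \<le> B" "\<And>x. x \<in> {a..b} \<Longrightarrow> h x \<le> B"
proof -
  from assms have "bounded (h ` {a..b})"
    by (simp add: locally_bounded_on_def)
  then obtain B where B: "\<And>x. x \<in> {a..b} \<Longrightarrow> norm (h x) \<le> B"
    unfolding bounded_iff by blast
  show ?thesis
    by (rule that[of "max 0 B"]) (use B in force)+
qed

lemma locally_bounded_on_add:
  assumes "locally_bounded_on I h" "locally_bounded_on I k"
  shows "locally_bounded_on I (\<lambda>x. h x + k x)"
  unfolding locally_bounded_on_def
proof (intro allI impI)
  fix a b assume "{a..b} \<subseteq> I"
  then have "bounded (h ` {a..b})" "bounded (k ` {a..b})"
    using assms by (auto simp: locally_bounded_on_def)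
  then show "bounded ((\<lambda>x. h x + k x) ` {a..b})"
    by (rule bounded_plus_comp)
qed

lemma dir_sum_eq_lap:
  "dir_sum I \<psi> \<theta> z = z + fps_nth \<psi> 0 + lap (continuation I (borel_minor \<psi>)) (cis \<theta>) z"
  by (simp only: dir_sum_def lap_def)

text \<open>Agreement is asked only of directions less than pi apart, between which the contour can
  be rotated. Directions further apart may see the same complex number on different sheets, with
  different sums.\<close>

definition coherent :: "real set \<Rightarrow> (real \<Rightarrow> real) \<Rightarrow> complex fps \<Rightarrow> bool" where
  "coherent I \<gamma> \<psi> \<longleftrightarrow> (\<forall>\<theta>1\<in>I. \<forall>\<theta>2\<in>I. \<forall>z. \<bar>\<theta>1 - \<theta>2\<bar> < pi \<longrightarrow>
     z \<in> half_plane \<theta>1 (\<gamma> \<theta>1) \<longrightarrow> z \<in> half_plane \<theta>2 (\<gamma> \<theta>2) \<longrightarrow> dir_sum I \<psi> \<theta>1 z = dir_sum I \<psi> \<theta>2 z)"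

text \<open>Local boundedness on the compact interval between two directions supplies the uniform
  amplitude and rate for the arc. The end rays keep their own rates, so that equality reaches the
  full intersection of the two half-planes.\<close>

lemma coherentI:
  assumes "borel_minor \<psi> \<in> N_bd I \<gamma> \<alpha>" and I: "open I" "is_interval I"
    and "locally_bounded_on I \<gamma>" "locally_bounded_on I \<alpha>"
  shows "coherent I \<gamma> \<psi>"
proof -
  let ?F = "continuation I (borel_minor \<psi>)"
  obtain r where r: "r > 0" "?F holomorphic_on ball 0 r \<union> sector I"
    and b: "\<And>\<theta> s. \<theta> \<in> I \<Longrightarrow> 0 \<le> s \<Longrightarrow> norm (?F (of_real s * cis \<theta>)) \<le> \<alpha> \<theta> * exp (\<gamma> \<theta> * s)"
    using N_bdE[OF assms(1) I] by metis
  interpret star_open "ball 0 r \<union> sector I"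
    by (rule star_open_borel_domain[OF I(1) r(1)])
  have *: "lap ?F (cis \<theta>1) z = lap ?F (cis \<theta>2) z"
    if \<theta>: "\<theta>1 \<in> I" "\<theta>2 \<in> I" "\<theta>1 < \<theta>2" "\<theta>2 - \<theta>1 < pi"
      and z: "z \<in> half_plane \<theta>1 (\<gamma> \<theta>1)" "z \<in> half_plane \<theta>2 (\<gamma> \<theta>2)" for \<theta>1 \<theta>2 z
  proof -
    have sub: "{\<theta>1..\<theta>2} \<subseteq> I"
      using mem_is_interval_1_I[OF I(2) \<theta>(1,2)] by auto
    obtain A where A: "0 \<le> A" "\<And>x. x \<in> {\<theta>1..\<theta>2} \<Longrightarrow> \<alpha> x \<le> A"
      using locally_bounded_on_upper[OF assms(5) sub] by blast
    obtain c where c: "0 \<le> c" "\<And>x. x \<in> {\<theta>1..\<theta>2} \<Longrightarrow> \<gamma> x \<le> c"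
      using locally_bounded_on_upper[OF assms(4) sub] by blast
    show ?thesis
    proof (rule lap_rotate[OF r(2) \<theta>(3,4) _ _ b[OF \<theta>(1)] b[OF \<theta>(2)] c(1) _ _ z])
      fix \<theta> s :: real assume t: "\<theta>1 \<le> \<theta>" "\<theta> \<le> \<theta>2" "0 \<le> s"
      then have \<theta>I: "\<theta> \<in> I"
        using sub by auto
      interpret star_ray "ball 0 r \<union> sector I" "cis \<theta>"
        by (rule star_ray_sector[OF I(1) r(1) \<theta>I])
      show "of_real s * cis \<theta> \<in> ball 0 r \<union> sector I"
        by (rule ray[OF t(3)])
      have "norm (?F (of_real s * cis \<theta>)) \<le> \<alpha> \<theta> * exp (\<gamma> \<theta> * s)"
        by (rule b[OF \<theta>I t(3)])
      also have "\<dots> \<le> A * exp (c * s)"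
        using A c t by (intro mult_mono) (auto intro: mult_right_mono)
      finally show "norm (?F (of_real s * cis \<theta>)) \<le> A * exp (c * s)" .
    qed (use c \<theta> in auto)
  qed
  show ?thesis
    unfolding coherent_def dir_sum_eq_lap
  proof (intro ballI allI impI)
    fix \<theta>1 \<theta>2 z
    assume I12: "\<theta>1 \<in> I" "\<theta>2 \<in> I" and less_pi: "\<bar>\<theta>1 - \<theta>2\<bar> < pi"
      and z: "z \<in> half_plane \<theta>1 (\<gamma> \<theta>1)" "z \<in> half_plane \<theta>2 (\<gamma> \<theta>2)"
    have d: "\<theta>2 - \<theta>1 < pi" "\<theta>1 - \<theta>2 < pi"
      using less_pi by linarith+
    have "lap ?F (cis \<theta>1) z = lap ?F (cis \<theta>2) z"
    proof (cases \<theta>1 \<theta>2 rule: linorder_cases)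
      case less
      show ?thesis
        by (rule *[OF I12 less d(1) z])
    next
      case greater
      show ?thesis
        by (rule *[OF I12(2,1) greater d(2) z(2,1), symmetric])
    qed simp
    then show "z + fps_nth \<psi> 0 + lap ?F (cis \<theta>1) z = z + fps_nth \<psi> 0 + lap ?F (cis \<theta>2) z"
      by (simp only:)
  qed
qed

text \<open>The margin \<gamma>1 - \<gamma> = |\<sigma>| + sqrt \<alpha> pays both for the growth of
  the composite in the Borel plane and for the displacement of z by \<open>f\<close>. The amplitude
  \<alpha> + \<beta> collects the bounds of \<phi> alone and of the composition series.\<close>

lemma composition_direction:
  fixes \<sigma> \<tau> :: complex
  assumes \<phi>: "borel_minor \<phi> \<in> N_bd I \<gamma> \<alpha>" "fps_nth \<phi> 0 = 0"
    and \<eta>: "borel_minor \<eta> \<in> N_bd I \<gamma> \<beta>" "fps_nth \<eta> 0 = 0"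
    and I: "open I" "is_interval I" and nonneg: "\<forall>\<theta>\<in>I. 0 \<le> \<alpha> \<theta>" "\<forall>\<theta>\<in>I. 0 \<le> \<beta> \<theta>"
    and f_def: "f = fps_const \<sigma> + \<phi>" and g_def: "g = fps_const \<tau> + \<eta>"
    and \<gamma>1_def: "\<gamma>1 = (\<lambda>\<theta>. \<gamma> \<theta> + norm \<sigma> + sqrt (\<alpha> \<theta>))"
  shows "borel_minor (tang_comp g f) \<in> N_bd I \<gamma>1 (\<lambda>\<theta>. \<alpha> \<theta> + \<beta> \<theta>)"
    and "\<And>\<theta> z. \<theta> \<in> I \<Longrightarrow> z \<in> half_plane \<theta> (\<gamma>1 \<theta>) \<Longrightarrow> dir_sum I f \<theta> z \<in> half_plane \<theta> (\<gamma> \<theta>)"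
    and "\<And>\<theta> z. \<theta> \<in> I \<Longrightarrow> z \<in> half_plane \<theta> (\<gamma>1 \<theta>) \<Longrightarrow>
      dir_sum I (tang_comp g f) \<theta> z = dir_sum I g \<theta> (dir_sum I f \<theta> z)"
proof -
  define F where "F = continuation I (borel_minor \<phi>)"
  define G where "G = continuation I (borel_minor \<eta>)"
  obtain r1 where r1: "r1 > 0" "F holomorphic_on ball 0 r1 \<union> sector I" "continues_to I (borel_minor \<phi>) F"
    and Fb: "\<And>\<theta> s. \<theta> \<in> I \<Longrightarrow> 0 \<le> s \<Longrightarrow> norm (F (of_real s * cis \<theta>)) \<le> \<alpha> \<theta> * exp (\<gamma> \<theta> * s)"
    using N_bdE[OF \<phi>(1) I] unfolding F_def by metis
  obtain r2 where r2: "r2 > 0" "G holomorphic_on ball 0 r2 \<union> sector I" "continues_to I (borel_minor \<eta>) G"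
    and Gb: "\<And>\<theta> s. \<theta> \<in> I \<Longrightarrow> 0 \<le> s \<Longrightarrow> norm (G (of_real s * cis \<theta>)) \<le> \<beta> \<theta> * exp (\<gamma> \<theta> * s)"
    using N_bdE[OF \<eta>(1) I] unfolding G_def by metis
  define S where "S = ball 0 (min r1 r2) \<union> sector I"
  have r: "min r1 r2 > 0"
    using r1 r2 by simp
  interpret star_open S
    unfolding S_def by (rule star_open_borel_domain[OF I(1) r])
  have F: "F holomorphic_on S"
    by (rule holomorphic_on_subset[OF r1(2)]) (auto simp: S_def)
  have G: "G holomorphic_on S"
    by (rule holomorphic_on_subset[OF r2(2)]) (auto simp: S_def)
  define K where "K = (\<lambda>\<zeta>. exp (- (\<sigma> * \<zeta>)) * G \<zeta>)"
  have K: "K holomorphic_on S"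
    unfolding K_def by (intro holomorphic_intros G)
  define \<kappa> where "\<kappa> = comp_fps (fps_const \<sigma>) \<eta>"
  define \<omega> where "\<omega> = \<phi> + comp_fps \<phi> \<kappa>"
  define H where "H = (\<lambda>\<zeta>. F \<zeta> + comp_series F K \<zeta>)"
  have \<kappa>0: "fps_nth \<kappa> 0 = 0"
    using comp_fps_nth_0[OF \<eta>(2)] by (simp add: \<kappa>_def)
  have comp: "tang_comp g f = fps_const (\<sigma> + \<tau>) + \<omega>"
    unfolding f_def g_def \<omega>_def \<kappa>_def by (rule tang_comp_decomp)
  have Fe: "F has_fps_expansion borel_minor \<phi>" and Ge: "G has_fps_expansion borel_minor \<eta>"
    using r1(3) r2(3) by (auto simp: continues_to_def)
  have "(\<lambda>\<zeta>. exp (- \<sigma> * \<zeta>) * G \<zeta>) has_fps_expansion fps_exp (- \<sigma>) * borel_minor \<eta>"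
    by (intro fps_expansion_intros Ge)
  then have Ke: "K has_fps_expansion borel_minor \<kappa>"
    by (simp add: K_def \<kappa>_def borel_minor_comp_fps_const[OF \<eta>(2)])
  have "comp_series F K has_fps_expansion borel_minor (comp_fps \<phi> \<kappa>)"
  proof (rule comp_series_has_fps_expansion[OF F K Fe \<phi>(2) Ke \<kappa>0])
    fix n
    show "\<forall>\<^sub>F N in sequentially. (\<Sum>p<N. fps_nth (fps_const (1 / fact p) * \<phi> ^ p * (dz ^^ p) \<kappa>) n) =
        fps_nth (comp_fps \<phi> \<kappa>) n"
      using eventually_gt_at_top[of n] by eventually_elim (rule comp_fps_nth)
  qed
  then have "H has_fps_expansion borel_minor \<phi> + borel_minor (comp_fps \<phi> \<kappa>)"
    unfolding H_def by (intro fps_expansion_intros Fe)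
  moreover have "borel_minor \<phi> + borel_minor (comp_fps \<phi> \<kappa>) = borel_minor \<omega>"
    by (intro fps_ext) (simp add: borel_minor_def \<omega>_def add_divide_distrib)
  moreover have "H holomorphic_on sector I"
    unfolding H_def
    by (intro holomorphic_intros holomorphic_on_subset[OF F] holomorphic_on_subset[OF comp_series_holomorphic[OF F K]])
       (auto simp: S_def)
  ultimately have H: "continues_to I (borel_minor (tang_comp g f)) H"
    by (simp add: continues_to_def comp borel_minor_const_add)
  \<comment> \<open>The rate of \<open>F\<close> is raised by |\<sigma>| so that \<open>F\<close>
    and \<open>K\<close> share one rate, as the convolution estimate demands.\<close>
  have Fb': "norm (F (of_real s * cis \<theta>)) \<le> \<alpha> \<theta> * exp ((\<gamma> \<theta> + norm \<sigma>) * s)" if "\<theta> \<in> I" "0 \<le> s" for \<theta> s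
    using that nonneg by (intro order_trans[OF Fb] mult_left_mono) (auto intro: mult_right_mono)
  have Kb: "norm (K (of_real s * cis \<theta>)) \<le> \<beta> \<theta> * exp ((\<gamma> \<theta> + norm \<sigma>) * s)" if "\<theta> \<in> I" "0 \<le> s" for \<theta> s
  proof -
    have "norm (exp (- (\<sigma> * (of_real s * cis \<theta>)))) \<le> exp (norm (- (\<sigma> * (of_real s * cis \<theta>))))"
      by (rule norm_exp)
    then have "norm (exp (- (\<sigma> * (of_real s * cis \<theta>)))) \<le> exp (norm \<sigma> * s)"
      using that by (simp add: norm_mult)
    then have "norm (K (of_real s * cis \<theta>)) \<le> exp (norm \<sigma> * s) * (\<beta> \<theta> * exp (\<gamma> \<theta> * s))"
      unfolding K_def norm_mult by (intro mult_mono Gb that) auto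
    then show ?thesis
      by (simp add: algebra_simps exp_add)
  qed
  show "borel_minor (tang_comp g f) \<in> N_bd I \<gamma>1 (\<lambda>\<theta>. \<alpha> \<theta> + \<beta> \<theta>)"
    unfolding N_bd_def mem_Collect_eq
  proof (intro exI conjI ballI allI impI)
    fix \<theta> \<xi> :: real assume \<theta>: "\<theta> \<in> I" and \<xi>: "0 < \<xi>"
    interpret star_ray S "cis \<theta>"
      unfolding S_def by (rule star_ray_sector[OF I(1) r \<theta>])
    have "norm (H (of_real \<xi> * cis \<theta>)) \<le> norm (F (of_real \<xi> * cis \<theta>)) + norm (comp_series F K (of_real \<xi> * cis \<theta>))"
      unfolding H_def by (rule norm_triangle_ineq)
    also have "norm (F (of_real \<xi> * cis \<theta>)) \<le> \<alpha> \<theta> * exp (\<gamma>1 \<theta> * \<xi>)"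
      using \<theta> \<xi> nonneg by (intro order_trans[OF Fb] mult_left_mono) (auto intro: mult_right_mono simp: \<gamma>1_def)
    also have "norm (comp_series F K (of_real \<xi> * cis \<theta>)) \<le> \<beta> \<theta> * exp (\<gamma>1 \<theta> * \<xi>)"
      using sum_comp_term_bound(3)[OF F K Fb'[OF \<theta>] Kb[OF \<theta>], of \<xi>] nonneg \<theta> \<xi> by (simp add: \<gamma>1_def)
    finally show "norm (H (of_real \<xi> * cis \<theta>)) \<le> (\<alpha> \<theta> + \<beta> \<theta>) * exp (\<gamma>1 \<theta> * \<xi>)"
      by (simp add: distrib_right)
  qed (rule H)
  fix \<theta> z assume \<theta>: "\<theta> \<in> I" and z: "z \<in> half_plane \<theta> (\<gamma>1 \<theta>)"
  interpret star_ray S "cis \<theta>"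
    unfolding S_def by (rule star_ray_sector[OF I(1) r \<theta>])
  have z': "Re (z * cis \<theta>) > (\<gamma> \<theta> + norm \<sigma>) + sqrt (\<alpha> \<theta>)"
    using z by (simp add: half_plane_def \<gamma>1_def)
  have A: "0 \<le> \<alpha> \<theta>" and B: "0 \<le> \<beta> \<theta>"
    using nonneg \<theta> by auto
  note L = lap_comp_series[OF F K Fb'[OF \<theta>] Kb[OF \<theta>] A B z']
  define \<Phi> where "\<Phi> = lap F (cis \<theta>) z"
  have f: "dir_sum I f \<theta> z = z + \<sigma> + \<Phi>"
    by (simp add: dir_sum_eq_lap f_def borel_minor_const_add \<phi>(2) \<Phi>_def F_def)
  have "\<bar>Re ((\<sigma> + \<Phi>) * cis \<theta>)\<bar> \<le> norm ((\<sigma> + \<Phi>) * cis \<theta>)"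
    by (rule abs_Re_le_cmod)
  also have "\<dots> \<le> norm \<sigma> + sqrt (\<alpha> \<theta>)"
    using L(1) norm_triangle_ineq[of \<sigma> \<Phi>] by (simp add: norm_mult \<Phi>_def)
  finally have "Re ((z + \<sigma> + \<Phi>) * cis \<theta>) > \<gamma> \<theta>"
    using z' by (simp add: algebra_simps abs_le_iff)
  then show "dir_sum I f \<theta> z \<in> half_plane \<theta> (\<gamma> \<theta>)"
    unfolding f half_plane_def by blast
  \<comment> \<open>\<open>continuation\<close> is an arbitrary choice for the composite too; along
    the ray it equals the explicit function \<open>H\<close>.\<close>
  have "lap (continuation I (borel_minor (tang_comp g f))) (cis \<theta>) z = lap H (cis \<theta>) z"
    by (intro lap_cong continues_to_unique[OF continues_to_continuation[OF H] H I] ray_in_sector \<theta>)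
  also have "\<dots> = \<Phi> + lap (comp_series F K) (cis \<theta>) z"
    unfolding H_def \<Phi>_def
  proof (rule lap_add)
    show "set_integrable lborel {0<..} (\<lambda>\<xi>. exp (- (z * of_real \<xi> * cis \<theta>)) * F (of_real \<xi> * cis \<theta>) * cis \<theta>)"
    proof (rule lap_integrable'[where A = "\<alpha> \<theta>" and c = "\<gamma> \<theta> + norm \<sigma>", OF F])
      show "Re (z * cis \<theta>) > \<gamma> \<theta> + norm \<sigma>"
        using z' real_sqrt_ge_zero[OF A] by linarith
    qed (use Fb'[OF \<theta>] in auto)
    show "set_integrable lborel {0<..} (\<lambda>\<xi>. exp (- (z * of_real \<xi> * cis \<theta>)) * comp_series F K (of_real \<xi> * cis \<theta>) * cis \<theta>)"
      by (rule lap_integrable'[where A = "\<beta> \<theta>", OF comp_series_holomorphic[OF F K] _ z'])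
         (use sum_comp_term_bound(3)[OF F K Fb'[OF \<theta>] Kb[OF \<theta>] A B] in auto)
  qed
  also have "lap (comp_series F K) (cis \<theta>) z = lap K (cis \<theta>) (z + \<Phi>)"
    unfolding \<Phi>_def by (rule L(2))
  also have "\<dots> = lap G (cis \<theta>) (z + \<Phi> + \<sigma>)"
    unfolding K_def by (rule lap_shift)
  also have "z + \<Phi> + \<sigma> = z + \<sigma> + \<Phi>"
    by (simp add: add_ac)
  finally have lap_h: "lap (continuation I (borel_minor (tang_comp g f))) (cis \<theta>) z = \<Phi> + lap G (cis \<theta>) (z + \<sigma> + \<Phi>)" .
  have h0: "fps_nth (tang_comp g f) 0 = \<sigma> + \<tau>"
    by (simp add: comp \<omega>_def \<phi>(2) comp_fps_nth_0[OF \<kappa>0])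
  have borel_g: "borel_minor g = borel_minor \<eta>" and g0: "fps_nth g 0 = \<tau>"
    by (simp_all add: g_def borel_minor_const_add \<eta>(2))
  show "dir_sum I (tang_comp g f) \<theta> z = dir_sum I g \<theta> (dir_sum I f \<theta> z)"
    unfolding f by (simp add: dir_sum_eq_lap h0 borel_g g0 lap_h flip: G_def)
qed

section \<open>Gluing the directions\<close>

text \<open>Length at most pi alone gives a weak inequality. Openness lets the right endpoint move
  outwards, which makes it strict.\<close>

lemma directions_less_pi:
  assumes "open I" "is_interval I" "emeasure lborel I \<le> ennreal pi" "\<theta>1 \<in> I" "\<theta>2 \<in> I"
  shows "\<bar>\<theta>1 - \<theta>2\<bar> < pi"
proof -
  have *: "b - a < pi" if ab: "a \<in> I" "b \<in> I" "a \<le> b" for a b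
  proof -
    obtain e where e: "e > 0" "cball b e \<subseteq> I"
      using open_contains_cball_eq[OF assms(1)] ab(2) by blast
    have "b + e \<in> cball b e"
      using e(1) by (simp add: dist_real_def)
    with e(2) have "b + e \<in> I"
      by (rule subsetD)
    then have "{a..b + e} \<subseteq> I"
      using mem_is_interval_1_I[OF assms(2) ab(1)] by auto
    then have "emeasure lborel {a..b + e} \<le> emeasure lborel I"
      using assms(1) by (intro emeasure_mono) auto
    then have "emeasure lborel {a..b + e} \<le> ennreal pi"
      using assms(3) by (rule order_trans)
    then have "ennreal (b + e - a) \<le> ennreal pi"
      using ab e by simp
    then show ?thesis
      using e by (simp add: ennreal_le_iff)
  qed
  from *[of \<theta>1 \<theta>2] *[of \<theta>2 \<theta>1] assms(4,5) show ?thesis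
    by (cases "\<theta>1 \<le> \<theta>2") auto
qed

lemma borel_sum_eq:
  assumes "coherent I \<gamma> \<psi>" and "\<And>\<theta>1 \<theta>2. \<theta>1 \<in> I \<Longrightarrow> \<theta>2 \<in> I \<Longrightarrow> \<bar>\<theta>1 - \<theta>2\<bar> < pi"
    and "\<theta> \<in> I" "z \<in> half_plane \<theta> (\<gamma> \<theta>)"
  shows "borel_sum I \<gamma> \<psi> z = dir_sum I \<psi> \<theta> z"
  unfolding borel_sum_def
proof (rule the_equality)
  show "\<forall>\<theta>'\<in>I. z \<in> half_plane \<theta>' (\<gamma> \<theta>') \<longrightarrow> dir_sum I \<psi> \<theta> z = dir_sum I \<psi> \<theta>' z"
    using assms unfolding coherent_def by blast
qed (use assms in blast)

text \<open>Since \<open>arccos\<close> is decreasing, its bound on |t + \<theta>| says r cos(t +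
  \<theta>) > c, once |t + \<theta>| < pi / 2 has singled out the sheet. This reduces lifted
  half-planes to plane ones.\<close>

lemma mem_log_half_plane:
  assumes "0 \<le> c"
  shows "p \<in> log_half_plane \<theta> c \<longleftrightarrow> 0 < fst p \<and> \<bar>snd p + \<theta>\<bar> < pi / 2 \<and> proj p \<in> half_plane \<theta> c"
proof -
  obtain r t where p: "p = (r, t)"
    by force
  have Re: "Re (proj p * cis \<theta>) = r * cos \<bar>t + \<theta>\<bar>"
    by (simp add: p proj_def rcis_def mult.assoc cis_mult)
  show ?thesis
  proof (cases "r > 0")
    case True
    have "c < r \<and> \<bar>t + \<theta>\<bar> < arccos (c / r) \<longleftrightarrow> \<bar>t + \<theta>\<bar> < pi / 2 \<and> c < r * cos \<bar>t + \<theta>\<bar>"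
    proof (intro iffI conjI; elim conjE)
      assume c: "c < r" and t: "\<bar>t + \<theta>\<bar> < arccos (c / r)"
      have cr: "0 \<le> c / r" "c / r \<le> 1"
        using assms True c by auto
      then have "arccos (c / r) \<le> pi / 2"
        using arccos_le_arccos[of 0 "c / r"] by simp
      with t show "\<bar>t + \<theta>\<bar> < pi / 2"
        by linarith
      have "cos (arccos (c / r)) < cos \<bar>t + \<theta>\<bar>"
        using t cr by (intro cos_monotone_0_pi arccos_ubound) auto
      then show "c < r * cos \<bar>t + \<theta>\<bar>"
        using cr True by (simp add: field_simps)
    next
      assume t: "\<bar>t + \<theta>\<bar> < pi / 2" and c: "c < r * cos \<bar>t + \<theta>\<bar>"
      have "r * cos \<bar>t + \<theta>\<bar> \<le> r * 1"
        using True by (intro mult_left_mono cos_le_one) auto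
      with c show "c < r"
        by simp
      have "c / r < cos \<bar>t + \<theta>\<bar>"
        using c True by (simp add: field_simps)
      then have "arccos (cos \<bar>t + \<theta>\<bar>) < arccos (c / r)"
        using assms True by (intro arccos_less_arccos cos_le_one) (auto intro: order_trans[of "-1" 0])
      moreover have "arccos (cos \<bar>t + \<theta>\<bar>) = \<bar>t + \<theta>\<bar>"
        by (rule arccos_cos) (use t pi_gt_zero in linarith)+
      ultimately show "\<bar>t + \<theta>\<bar> < arccos (c / r)"
        by (simp only:)
    qed
    with True Re show ?thesis
      by (simp add: p log_half_plane_def half_plane_def)
  qed (use assms in \<open>auto simp: p log_half_plane_def\<close>)
qed

lemma log_half_plane_mono:
  assumes "0 \<le> c" "c \<le> d"
  shows "log_half_plane \<theta> d \<subseteq> log_half_plane \<theta> c"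
  using assms by (auto simp: mem_log_half_plane half_plane_def)

text \<open>The argument of \<open>p\<close> lies within pi / 2 of both -\<theta>1 and -\<theta>2.
  On the surface this takes the place of the condition on the length of I.\<close>

lemma log_half_plane_directions:
  assumes "0 \<le> c1" "0 \<le> c2" "p \<in> log_half_plane \<theta>1 c1" "p \<in> log_half_plane \<theta>2 c2"
  shows "\<bar>\<theta>1 - \<theta>2\<bar> < pi"
proof -
  have "\<bar>snd p + \<theta>1\<bar> < pi / 2"
    using assms(3) unfolding mem_log_half_plane[OF assms(1)] by blast
  moreover have "\<bar>snd p + \<theta>2\<bar> < pi / 2"
    using assms(4) unfolding mem_log_half_plane[OF assms(2)] by blast
  ultimately show ?thesis
    by linarith
qed

lemma log_borel_sum_eq:
  assumes "coherent I \<gamma> \<psi>" and pos: "\<And>\<theta>. \<theta> \<in> I \<Longrightarrow> 0 \<le> \<gamma> \<theta>"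
    and "\<theta> \<in> I" "p \<in> log_half_plane \<theta> (\<gamma> \<theta>)"
  shows "log_borel_sum I \<gamma> \<psi> p = dir_sum I \<psi> \<theta> (proj p)"
  unfolding log_borel_sum_def
proof (rule the_equality)
  show "\<forall>\<theta>'\<in>I. p \<in> log_half_plane \<theta>' (\<gamma> \<theta>') \<longrightarrow> dir_sum I \<psi> \<theta> (proj p) = dir_sum I \<psi> \<theta>' (proj p)"
  proof (intro ballI impI)
    fix \<theta>' assume \<theta>': "\<theta>' \<in> I" "p \<in> log_half_plane \<theta>' (\<gamma> \<theta>')"
    have "\<bar>\<theta> - \<theta>'\<bar> < pi"
      using pos assms \<theta>' by (intro log_half_plane_directions[of "\<gamma> \<theta>" "\<gamma> \<theta>'" p]) auto
    moreover have "proj p \<in> half_plane \<theta> (\<gamma> \<theta>)" "proj p \<in> half_plane \<theta>' (\<gamma> \<theta>')"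
      using assms(4) \<theta>'(2) mem_log_half_plane[OF pos[OF assms(3)]] mem_log_half_plane[OF pos[OF \<theta>'(1)]]
      by blast+
    ultimately show "dir_sum I \<psi> \<theta> (proj p) = dir_sum I \<psi> \<theta>' (proj p)"
      using assms(1,3) \<theta>'(1) unfolding coherent_def by blast
  qed
qed (use assms in blast)

text \<open>The arguments differ by a multiple of 2 pi and by less than pi / 2 + pi / 2 + pi, hence
  not at all.\<close>

lemma log_lift_unique:
  assumes "q1 \<in> log_half_plane \<theta>1 0" "q2 \<in> log_half_plane \<theta>2 0" "\<bar>\<theta>1 - \<theta>2\<bar> < pi" "proj q1 = proj q2"
  shows "q1 = q2"
proof -
  obtain r1 t1 r2 t2 where q: "q1 = (r1, t1)" "q2 = (r2, t2)"
    by force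
  have r: "r1 > 0" "r2 > 0" and t: "\<bar>t1 + \<theta>1\<bar> < pi / 2" "\<bar>t2 + \<theta>2\<bar> < pi / 2"
    using assms(1,2) by (auto simp: mem_log_half_plane q)
  have eq: "rcis r1 t1 = rcis r2 t2"
    using assms(4) by (simp add: proj_def q)
  then have "norm (rcis r1 t1) = norm (rcis r2 t2)"
    by simp
  then have r12: "r1 = r2"
    using r by simp
  then have "cis t1 = cis t2"
    using eq r by (simp add: rcis_def)
  then have "sin t1 = sin t2 \<and> cos t1 = cos t2"
    by (simp add: complex_eq_iff)
  then obtain n :: int where n: "t1 = t2 + 2 * pi * n"
    using sin_cos_eq_iff by auto
  have "\<bar>t1 - t2\<bar> < 2 * pi"
    using t assms(3) by linarith
  then have "2 * pi * \<bar>real_of_int n\<bar> < 2 * pi * 1"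
    by (simp add: n abs_mult)
  then have "\<bar>real_of_int n\<bar> < 1"
    by (rule mult_left_less_imp_less) simp
  then have "n = 0"
    by linarith
  with r12 n show ?thesis
    by (simp add: q)
qed

text \<open>The principal logarithm of v e^(i \<theta>) has imaginary part strictly between -pi / 2
  and pi / 2. Subtracting \<theta> gives the argument of the lift.\<close>

lemma log_lift_exists:
  assumes "0 < Re (v * cis \<theta>)"
  shows "\<exists>q. q \<in> log_half_plane \<theta> 0 \<and> proj q = v"
proof -
  define L where "L = Ln (v * cis \<theta>)"
  have nz: "v * cis \<theta> \<noteq> 0"
    using assms by auto
  have Im: "\<bar>Im L\<bar> < pi / 2"
    unfolding L_def using assms nz Re_Ln_pos_lt by blast
  have e: "v * cis \<theta> = of_real (exp (Re L)) * cis (Im L)"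
    using exp_Ln[OF nz] by (simp add: L_def exp_eq_polar)
  let ?q = "(exp (Re L), Im L - \<theta>)"
  have "proj ?q = of_real (exp (Re L)) * cis (Im L) * cis (- \<theta>)"
    by (simp add: proj_def rcis_def mult.assoc cis_mult)
  also have "\<dots> = v"
    unfolding e[symmetric] by (simp add: mult.assoc cis_mult)
  finally have "proj ?q = v" .
  moreover from this have "?q \<in> log_half_plane \<theta> 0"
    using Im assms by (simp add: mem_log_half_plane half_plane_def)
  ultimately show ?thesis
    by blast
qed

text \<open>A competing lift may come from another admissible direction. Coherence gives it the same
  complex value, and the two directions are less than pi apart, so uniqueness of lifts
  applies.\<close>

lemma log_lift_eq:
  assumes coh: "coherent I \<gamma> \<psi>" and pos: "\<And>\<theta>. \<theta> \<in> I \<Longrightarrow> 0 \<le> \<gamma> \<theta>"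
    and \<theta>: "\<theta> \<in> I" "p \<in> log_half_plane \<theta> (\<gamma> \<theta>)" and q: "q \<in> log_half_plane \<theta> 0" "proj q = dir_sum I \<psi> \<theta> (proj p)"
  shows "log_lift I \<gamma> \<psi> p = q"
  unfolding log_lift_def
proof (rule the_equality)
  show "\<exists>\<theta>\<in>I. p \<in> log_half_plane \<theta> (\<gamma> \<theta>) \<and> q \<in> log_half_plane \<theta> 0 \<and> proj q = dir_sum I \<psi> \<theta> (proj p)"
    using \<theta> q by blast
  fix q' assume "\<exists>\<theta>\<in>I. p \<in> log_half_plane \<theta> (\<gamma> \<theta>) \<and> q' \<in> log_half_plane \<theta> 0 \<and> proj q' = dir_sum I \<psi> \<theta> (proj p)"
  then obtain \<theta>' where \<theta>': "\<theta>' \<in> I" "p \<in> log_half_plane \<theta>' (\<gamma> \<theta>')"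
    and q': "q' \<in> log_half_plane \<theta>' 0" "proj q' = dir_sum I \<psi> \<theta>' (proj p)"
    by blast
  have "\<bar>\<theta>' - \<theta>\<bar> < pi"
    using pos \<theta> \<theta>' by (intro log_half_plane_directions[of "\<gamma> \<theta>'" "\<gamma> \<theta>" p]) auto
  moreover have "proj q' = proj q"
    using log_borel_sum_eq[OF coh pos \<theta>] log_borel_sum_eq[OF coh pos \<theta>'] q q' by simp
  ultimately show "q' = q"
    using q(1) q'(1) log_lift_unique by blast
qed

text \<open>On the surface the lift for \<open>f\<close> always exists, as its value times e^(i
  \<theta>) has real part above \<gamma> > 0. The value of the composite is not confined to such a
  half-plane, which is why the equality of lifts carries a positivity condition.\<close>

theorem theorem17p2:
  fixes I :: "real set" and \<gamma> \<alpha> \<gamma>1 :: "real \<Rightarrow> real"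
    and \<sigma> \<tau> :: complex and f g :: "complex fps"
  assumes "open I" and "is_interval I" and "I \<noteq> {}"
    and "locally_bounded_on I \<gamma>" and "locally_bounded_on I \<alpha>"
    and "\<forall>\<theta>\<in>I. 0 \<le> \<alpha> \<theta>"
    and "f \<in> G_bd \<sigma> I \<gamma> \<alpha>" and "g \<in> G_sp \<tau> I \<gamma>"
    and "\<gamma>1 = (\<lambda>\<theta>. \<gamma> \<theta> + norm \<sigma> + sqrt (\<alpha> \<theta>))"
  shows "tang_comp g f \<in> G_sp (\<sigma> + \<tau>) I \<gamma>1
    \<and> (emeasure lborel I \<le> ennreal pi \<longrightarrow>
          borel_sum I \<gamma> f ` D_dom I \<gamma>1 \<subseteq> D_dom I \<gamma>
        \<and> (\<forall>z \<in> D_dom I \<gamma>1.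
              borel_sum I \<gamma>1 (tang_comp g f) z = borel_sum I \<gamma> g (borel_sum I \<gamma> f z)))
    \<and> (emeasure lborel I > ennreal pi \<and> (\<forall>\<theta>\<in>I. 0 < \<gamma> \<theta>) \<longrightarrow>
          log_lift I \<gamma> f ` log_D_dom I \<gamma>1 \<subseteq> log_D_dom I \<gamma>
        \<and> (\<forall>p \<in> log_D_dom I \<gamma>1. proj (log_lift I \<gamma> f p) = log_borel_sum I \<gamma> f p)
        \<and> (\<forall>p \<in> log_D_dom I \<gamma>1.
              log_borel_sum I \<gamma>1 (tang_comp g f) p = log_borel_sum I \<gamma> g (log_lift I \<gamma> f p))
        \<and> (\<forall>\<theta>\<in>I. \<forall>p \<in> log_half_plane \<theta> (\<gamma>1 \<theta>).
              0 < Re (log_borel_sum I \<gamma>1 (tang_comp g f) p * cis \<theta>) \<longrightarrow>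
              log_lift I \<gamma>1 (tang_comp g f) p = log_lift I \<gamma> g (log_lift I \<gamma> f p)))"
proof -
  note I = assms(1,2)
  obtain \<phi> where f: "f = fps_const \<sigma> + \<phi>" and \<phi>: "borel_minor \<phi> \<in> N_bd I \<gamma> \<alpha>" "fps_nth \<phi> 0 = 0"
    using assms(7) by (auto simp: G_bd_def)
  obtain \<eta> \<beta> where g: "g = fps_const \<tau> + \<eta>" and \<eta>: "borel_minor \<eta> \<in> N_bd I \<gamma> \<beta>" "fps_nth \<eta> 0 = 0"
    and \<beta>: "locally_bounded_on I \<beta>" "\<forall>\<theta>\<in>I. 0 \<le> \<beta> \<theta>"
    using assms(8) by (auto simp: G_sp_def N_sp_def)
  let ?h = "tang_comp g f"
  note C = composition_direction[OF \<phi> \<eta> I assms(6) \<beta>(2) f g assms(9)]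
  have \<gamma>_le: "\<gamma> \<theta> \<le> \<gamma>1 \<theta>" if "\<theta> \<in> I" for \<theta>
    using assms(6) that by (simp add: assms(9))
  \<comment> \<open>This makes \<gamma>1 locally bounded, as coherence of the composite
    requires.\<close>
  have lb_sqrt: "locally_bounded_on I (\<lambda>\<theta>. norm \<sigma> + sqrt (\<alpha> \<theta>))"
    unfolding locally_bounded_on_def
  proof (intro allI impI)
    fix a b assume sub: "{a..b} \<subseteq> I"
    obtain B where B: "0 \<le> B" "\<And>x. x \<in> {a..b} \<Longrightarrow> \<alpha> x \<le> B"
      using locally_bounded_on_upper[OF assms(5) sub] by blast
    show "bounded ((\<lambda>\<theta>. norm \<sigma> + sqrt (\<alpha> \<theta>)) ` {a..b})"
      unfolding bounded_iff
    proof (intro exI ballI)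
      fix y assume "y \<in> (\<lambda>\<theta>. norm \<sigma> + sqrt (\<alpha> \<theta>)) ` {a..b}"
      then obtain x where x: "x \<in> {a..b}" "y = norm \<sigma> + sqrt (\<alpha> x)"
        by blast
      then have "0 \<le> \<alpha> x"
        using assms(6) sub by blast
      with x B(2)[OF x(1)] show "norm y \<le> norm \<sigma> + sqrt B"
        by simp
    qed
  qed
  have lb1: "locally_bounded_on I \<gamma>1"
    using locally_bounded_on_add[OF assms(4) lb_sqrt] by (simp add: assms(9) add.assoc)
  have lb2: "locally_bounded_on I (\<lambda>\<theta>. \<alpha> \<theta> + \<beta> \<theta>)"
    by (rule locally_bounded_on_add[OF assms(5) \<beta>(1)])
  have cf: "coherent I \<gamma> f" and cg: "coherent I \<gamma> g" and ch: "coherent I \<gamma>1 ?h"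
    using coherentI[of f, OF _ I assms(4,5)] coherentI[of g, OF _ I assms(4) \<beta>(1)] \<phi>(1) \<eta>(1)
      coherentI[OF C(1) I lb1 lb2] by (auto simp: f g borel_minor_const_add)
  have "?h \<in> G_sp (\<sigma> + \<tau>) I \<gamma>1"
  proof -
    define \<omega> where "\<omega> = \<phi> + comp_fps \<phi> (comp_fps (fps_const \<sigma>) \<eta>)"
    have h: "?h = fps_const (\<sigma> + \<tau>) + \<omega>"
      unfolding f g \<omega>_def by (rule tang_comp_decomp)
    have "fps_nth \<omega> 0 = 0"
      by (simp add: \<omega>_def \<phi>(2) \<eta>(2) comp_fps_nth_0)
    moreover have "borel_minor \<omega> \<in> N_sp I \<gamma>1"
      using C(1) lb2 assms(6) \<beta>(2) unfolding N_sp_def h borel_minor_const_add by auto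
    ultimately show ?thesis
      using h unfolding G_sp_def by blast
  qed
  moreover have "borel_sum I \<gamma> f ` D_dom I \<gamma>1 \<subseteq> D_dom I \<gamma>
        \<and> (\<forall>z \<in> D_dom I \<gamma>1. borel_sum I \<gamma>1 ?h z = borel_sum I \<gamma> g (borel_sum I \<gamma> f z))"
    if "emeasure lborel I \<le> ennreal pi"
  proof -
    note less_pi = directions_less_pi[OF I that]
    \<comment> \<open>One direction is admissible for all three sums: for \<open>f\<close> and the
      composite at z, and for \<open>g\<close> at the value of \<open>f\<close>.\<close>
    have *: "borel_sum I \<gamma> f z \<in> half_plane \<theta> (\<gamma> \<theta>) \<and> borel_sum I \<gamma>1 ?h z = borel_sum I \<gamma> g (borel_sum I \<gamma> f z)"
      if \<theta>: "\<theta> \<in> I" and z: "z \<in> half_plane \<theta> (\<gamma>1 \<theta>)" for \<theta> z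
    proof -
      have "z \<in> half_plane \<theta> (\<gamma> \<theta>)"
        using z \<gamma>_le[OF \<theta>] by (simp add: half_plane_def)
      then have "borel_sum I \<gamma> f z = dir_sum I f \<theta> z"
        by (intro borel_sum_eq[OF cf less_pi \<theta>])
      then show ?thesis
        using C(2,3)[OF \<theta> z] borel_sum_eq[OF ch less_pi \<theta> z]
          borel_sum_eq[OF cg less_pi \<theta> C(2)[OF \<theta> z]] by simp
    qed
    then show ?thesis
      unfolding D_dom_def by blast
  qed
  moreover have "log_lift I \<gamma> f ` log_D_dom I \<gamma>1 \<subseteq> log_D_dom I \<gamma>
        \<and> (\<forall>p \<in> log_D_dom I \<gamma>1. proj (log_lift I \<gamma> f p) = log_borel_sum I \<gamma> f p)
        \<and> (\<forall>p \<in> log_D_dom I \<gamma>1.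
              log_borel_sum I \<gamma>1 ?h p = log_borel_sum I \<gamma> g (log_lift I \<gamma> f p))
        \<and> (\<forall>\<theta>\<in>I. \<forall>p \<in> log_half_plane \<theta> (\<gamma>1 \<theta>).
              0 < Re (log_borel_sum I \<gamma>1 ?h p * cis \<theta>) \<longrightarrow>
              log_lift I \<gamma>1 ?h p = log_lift I \<gamma> g (log_lift I \<gamma> f p))"
    if pos: "\<forall>\<theta>\<in>I. 0 < \<gamma> \<theta>"
  proof -
    have pos0: "0 \<le> \<gamma> \<theta>" if "\<theta> \<in> I" for \<theta>
      using pos that by force
    have pos1: "0 \<le> \<gamma>1 \<theta>" if "\<theta> \<in> I" for \<theta>
      using pos0[OF that] \<gamma>_le[OF that] by simp
    have *: "log_lift I \<gamma> f p \<in> log_half_plane \<theta> (\<gamma> \<theta>)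
        \<and> proj (log_lift I \<gamma> f p) = log_borel_sum I \<gamma> f p
        \<and> log_borel_sum I \<gamma>1 ?h p = log_borel_sum I \<gamma> g (log_lift I \<gamma> f p)
        \<and> (0 < Re (log_borel_sum I \<gamma>1 ?h p * cis \<theta>) \<longrightarrow>
              log_lift I \<gamma>1 ?h p = log_lift I \<gamma> g (log_lift I \<gamma> f p))"
      if \<theta>: "\<theta> \<in> I" and p: "p \<in> log_half_plane \<theta> (\<gamma>1 \<theta>)" for \<theta> p
    proof -
      have z: "proj p \<in> half_plane \<theta> (\<gamma>1 \<theta>)"
        using p pos1[OF \<theta>] by (simp add: mem_log_half_plane)
      have p': "p \<in> log_half_plane \<theta> (\<gamma> \<theta>)"
        using log_half_plane_mono[OF pos0[OF \<theta>] \<gamma>_le[OF \<theta>]] p by blast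
      define v where "v = dir_sum I f \<theta> (proj p)"
      have v: "v \<in> half_plane \<theta> (\<gamma> \<theta>)"
        unfolding v_def by (rule C(2)[OF \<theta> z])
      then have "0 < Re (v * cis \<theta>)"
        using pos0[OF \<theta>] by (simp add: half_plane_def)
      then obtain q where q: "q \<in> log_half_plane \<theta> 0" "proj q = v"
        using log_lift_exists by blast
      have lf: "log_lift I \<gamma> f p = q"
        using q by (intro log_lift_eq[OF cf pos0 \<theta> p']) (auto simp: v_def)
      have q': "q \<in> log_half_plane \<theta> (\<gamma> \<theta>)"
        using q v pos0[OF \<theta>] by (simp add: mem_log_half_plane)
      have sf: "log_borel_sum I \<gamma> f p = v"
        unfolding v_def by (rule log_borel_sum_eq[OF cf pos0 \<theta> p'])
      have sg: "log_borel_sum I \<gamma> g q = dir_sum I g \<theta> v"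
        using log_borel_sum_eq[OF cg pos0 \<theta> q'] q(2) by simp
      have sh: "log_borel_sum I \<gamma>1 ?h p = dir_sum I g \<theta> v"
        using log_borel_sum_eq[OF ch pos1 \<theta> p] C(3)[OF \<theta> z] by (simp add: v_def)
      \<comment> \<open>Both sides are the lift of one complex value in the direction \<theta>,
        which is admissible at \<open>p\<close> for the composite and at \<open>q\<close> for
        \<open>g\<close>.\<close>
      have "log_lift I \<gamma>1 ?h p = log_lift I \<gamma> g q" if Re_pos: "0 < Re (dir_sum I g \<theta> v * cis \<theta>)"
      proof -
        obtain q2 where q2: "q2 \<in> log_half_plane \<theta> 0" "proj q2 = dir_sum I g \<theta> v"
          using log_lift_exists[OF Re_pos] by blast
        have "log_lift I \<gamma>1 ?h p = q2"
          using q2 C(3)[OF \<theta> z] by (intro log_lift_eq[OF ch pos1 \<theta> p]) (auto simp: v_def)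
        moreover have "log_lift I \<gamma> g q = q2"
          using q2 q(2) by (intro log_lift_eq[OF cg pos0 \<theta> q']) auto
        ultimately show ?thesis by simp
      qed
      with lf q' q sf sg sh show ?thesis
        by simp
    qed
    have D: "log_D_dom I c = (\<Union>\<theta>\<in>I. log_half_plane \<theta> (c \<theta>))" for c
      by (rule log_D_dom_def)
    show ?thesis
      unfolding D using * by blast
  qed
  ultimately show ?thesis
    by blast
qed

end
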